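(* (i) If $f\in \mathcal{S}_1\cap \dot W^{1,2}(\mathbb{C},\mathbb{C})$, then $$\int_{\mathbb{C}} L(\partial f,\overline{\partial} f)=0.$$ (ii) If $1<p\le 2$ and $f\in \mathcal{S}_1\cap \dot W^{1,p}(\mathbb{C},\mathbb{C})$, then $$\int_{\mathbb{C}} \Phi_p(\partial f,\overline{\partial} f)=0.$$ (iii) If $2\le p<\infty$ and $f\in \mathcal{S}_1\cap \dot W^{1,p}(\mathbb{C},\mathbb{C})$, then $$\int_{\mathbb{C}} \Phi_p(\overline{\partial} f,\partial f)=0.$$
   Context: For $f:\mathbb{C}\to\mathbb{C}$, with $z=x+iy$, the formal complex derivatives are $\partial f=\frac12\left(\frac{\partial f}{\partial x}-i\frac{\partial f}{\partial y}\right)$ and $\overline{\partial} f=\frac12\left(\frac{\partial f}{\partial x}+i\frac{\partial f}{\partial y}\right)$. $\dot W^{1,p}(\mathbb{C},\mathbb{C})$ is the homogeneous Sobolev space of complex-valued locally integrable functions on the plane whose distributional first derivatives are in $L^p$ of the plane. Integrals are with respect to Lebesgue measure on $\mathbb{C}$. The function $L:\mathbb{C}\times\mathbb{C}\to\mathbb{R}$ is $L(z,w)=|z|^2-|w|^2$ if $|z|+|w|\le 1$, and $L(z,w)=2|z|-1$ if $|z|+|w|>1$. For $p\in(1,\infty)$, let $p^*=\max(p,p')$ where $\frac1p+\frac1{p'}=1$, and define $\Phi_p:\mathbb{C}\times\mathbb{C}\to\mathbb{R}$ by $$\Phi_p(z,w)=\alpha_p\,\big((p^*-1)|z|-|w|\big)\,(|z|+|w|)^{p-1},\qquad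 \alpha_p=p\left(1-\frac1{p^*}\right)^{p-1}.$$ A stretch function is a function $f:\mathbb{C}\to\mathbb{C}$ of the form $f(re^{i\theta})=g(r)e^{i\theta}$, where $g$ is a nonnegative locally Lipschitz function on $(0,\infty)$ with $g(0):=g(0+)=0$ and $\lim_{r\to\infty}g(r)=0$. $\mathcal{S}$ denotes the set of all stretch functions, and $\mathcal{S}_1$ denotes the subclass of those $f\in\mathcal{S}$ whose $g$ satisfies $|g'(r)|\le r^{-1}g(r)$ for a.e. $r\in[0,\infty)$. *)

theory Defs
  imports "HOL-Analysis.Analysis"
begin

section \<open>Distributional derivatives and homogeneous Sobolev spaces on the plane\<close>

definition locally_integrable :: "(complex \<Rightarrow> complex) \<Rightarrow> bool" where
  "locally_integrable f \<longleftrightarrow> (\<forall>K. compact K \<longrightarrow> f absolutely_integrable_on K)"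

text \<open>The derivative in direction 1 is the partial derivative in \<open>x\<close>,
  the one in direction \<open>\<i>\<close> is the partial derivative in \<open>y\<close>.\<close>

definition dir_deriv :: "complex \<Rightarrow> (complex \<Rightarrow> real) \<Rightarrow> complex \<Rightarrow> real" where
  "dir_deriv v \<phi> z = frechet_derivative \<phi> (at z) v"

fun C_k :: "nat \<Rightarrow> (complex \<Rightarrow> real) \<Rightarrow> bool" where
  "C_k 0 \<phi> \<longleftrightarrow> continuous_on UNIV \<phi>"
| "C_k (Suc k) \<phi> \<longleftrightarrow>
     (\<forall>z. \<phi> differentiable (at z)) \<and> C_k k (dir_deriv 1 \<phi>) \<and> C_k k (dir_deriv \<i> \<phi>)"

definition test_function :: "(complex \<Rightarrow> real) \<Rightarrow> bool" where
  "test_function \<phi> \<longleftrightarrow> (\<forall>k. C_k k \<phi>) \<and> compact (closure {z. \<phi> z \<noteq> 0})"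

definition is_weak_deriv ::
    "complex \<Rightarrow> (complex \<Rightarrow> complex) \<Rightarrow> (complex \<Rightarrow> complex) \<Rightarrow> bool" where
  "is_weak_deriv v f h \<longleftrightarrow>
     locally_integrable f \<and> locally_integrable h \<and>
     (\<forall>\<phi>. test_function \<phi> \<longrightarrow>
        (LINT z|lebesgue. dir_deriv v \<phi> z *\<^sub>R f z) = - (LINT z|lebesgue. \<phi> z *\<^sub>R h z))"

text \<open>A weak derivative is determined only up to a null set; \<open>weak_deriv v f\<close> is some
  representative (unspecified if \<open>f\<close> has no weak derivative in direction \<open>v\<close>).\<close>

definition weak_deriv :: "complex \<Rightarrow> (complex \<Rightarrow> complex) \<Rightarrow> complex \<Rightarrow> complex" where
  "weak_deriv v f = (SOME h. is_weak_deriv v f h)"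

definition in_Lp :: "real \<Rightarrow> (complex \<Rightarrow> complex) \<Rightarrow> bool" where
  "in_Lp p h \<longleftrightarrow>
     h \<in> borel_measurable lebesgue \<and> integrable lebesgue (\<lambda>z. norm (h z) powr p)"

definition hom_sobolev :: "real \<Rightarrow> (complex \<Rightarrow> complex) set" where
  "hom_sobolev p =
     {f. locally_integrable f \<and> (\<forall>v \<in> {1, \<i>}. \<exists>h. is_weak_deriv v f h \<and> in_Lp p h)}"

definition d_z :: "(complex \<Rightarrow> complex) \<Rightarrow> complex \<Rightarrow> complex" where
  "d_z f z = (weak_deriv 1 f z - \<i> * weak_deriv \<i> f z) / 2"

definition d_zbar :: "(complex \<Rightarrow> complex) \<Rightarrow> complex \<Rightarrow> complex" where
  "d_zbar f z = (weak_deriv 1 f z + \<i> * weak_deriv \<i> f z) / 2"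


section \<open>The functions \<open>L\<close> and \<open>\<Phi>\<^sub>p\<close>\<close>

definition L_fun :: "complex \<Rightarrow> complex \<Rightarrow> real" where
  "L_fun z w = (if norm z + norm w \<le> 1 then (norm z)\<^sup>2 - (norm w)\<^sup>2 else 2 * norm z - 1)"

definition p_star :: "real \<Rightarrow> real" where
  "p_star p = max p (p / (p - 1))"

definition alpha :: "real \<Rightarrow> real" where
  "alpha p = p * (1 - 1 / p_star p) powr (p - 1)"

definition Phi :: "real \<Rightarrow> complex \<Rightarrow> complex \<Rightarrow> real" where
  "Phi p z w =
     alpha p * ((p_star p - 1) * norm z - norm w) * (norm z + norm w) powr (p - 1)"


section \<open>Stretch functions\<close>

text \<open>The values of \<open>g\<close> on the negative reals are irrelevant.\<close>

definition stretch_profile :: "(real \<Rightarrow> real) \<Rightarrow> bool" where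
  "stretch_profile g \<longleftrightarrow>
     (\<forall>r>0. 0 \<le> g r) \<and>
     local_lipschitz (UNIV :: real set) {0<..} (\<lambda>_. g) \<and>
     g 0 = 0 \<and> (g \<longlongrightarrow> 0) (at_right 0) \<and>
     (g \<longlongrightarrow> 0) at_top"

definition is_stretch_of :: "(complex \<Rightarrow> complex) \<Rightarrow> (real \<Rightarrow> real) \<Rightarrow> bool" where
  "is_stretch_of f g \<longleftrightarrow>
     stretch_profile g \<and> (\<forall>r\<ge>0. \<forall>\<theta>. f (of_real r * cis \<theta>) = of_real (g r) * cis \<theta>)"

definition stretch_functions :: "(complex \<Rightarrow> complex) set" where
  "stretch_functions = {f. \<exists>g. is_stretch_of f g}"

text \<open>A locally Lipschitz \<open>g\<close> is differentiable almost everywhere on \<open>(0,\<infinity>)\<close>, so asking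
  for the derivative to exist in the almost-everywhere condition is no restriction.\<close>

definition stretch_functions1 :: "(complex \<Rightarrow> complex) set" where
  "stretch_functions1 =
     {f \<in> stretch_functions. \<exists>g. is_stretch_of f g \<and>
        (AE r in lebesgue. 0 < r \<longrightarrow>
           (\<exists>g'. (g has_real_derivative g') (at r) \<and> \<bar>g'\<bar> \<le> g r / r))}"

end

theory Submission
  imports Defs
begin

text \<open>For a stretch function with profile \<open>g\<close> satisfying \<open>\<bar>g' r\<bar> \<le> g r / r\<close>, put \<open>q r = g r / r\<close>. At almost
  every \<open>z\<close> with \<open>\<bar>z\<bar> = r\<close> the complex derivatives satisfy \<open>\<bar>d_z f z\<bar> = (q r + g' r) / 2\<close> and
  \<open>\<bar>d_zbar f z\<bar> = (q r - g' r) / 2\<close>; the assumption on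
  \<open>g'\<close> is exactly what removes the absolute values. Hence every integrand in the theorem is a radial
  function, and the point is that it is a total derivative in \<open>r\<close>.

  All three cases are one computation. For a continuously differentiable \<open>\<psi>\<close> and \<open>F r = r\<^sup>2 \<psi> (q r)\<close>,
  the identity \<open>r q' = g' - q\<close> gives \<open>F' r = 2 r (\<psi> (a + b) - b \<psi>' (a + b))\<close> with
  \<open>a = \<bar>d_z f z\<bar>\<close> and \<open>b = \<bar>d_zbar f z\<bar>\<close>. In polar coordinates the integral of \<open>\<psi> (a + b) - b \<psi>' (a + b)\<close>
  over the plane is therefore \<open>\<pi>\<close> times the integral of \<open>F'\<close> over the half-line. The function \<open>L\<close>
  arises from \<open>\<psi> t = t\<^sup>2 - (max 0 (t - 1))\<^sup>2\<close>, and both \<open>\<Phi>\<^sub>p\<close> arise, up to constant factors, from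
  \<open>\<psi> t = t\<^sup>p\<close> (lemma \<open>integral_radial_potential_eq_0\<close>).

  The boundary terms vanish by integrability. Membership of the gradient in \<open>L\<^sup>p\<close> makes
  \<open>q\<^sup>p\<close> integrable over the plane, so \<open>F'\<close> and \<open>F r / r\<close> are integrable over the half-line; since \<open>1 / r\<close> is
  integrable neither at \<open>0\<close> nor at \<open>\<infinity>\<close>, the function \<open>F\<close> is arbitrarily small along sequences tending to
  both ends (lemma \<open>integral_derivative_half_line_eq_0\<close>).

  What remains is to see that the weak derivatives are the classical ones. Off the
  origin \<open>f\<close> is locally Lipschitz and differentiable almost everywhere, which suffices for an integration
  by parts against test functions supported away from \<open>0\<close>
  (lemma \<open>integration_by_parts_test_function\<close>); the fundamental lemma of the calculus of
  variations (lemma \<open>AE_zero_if_orthogonal_to_smooth\<close>) then identifies the two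
  (lemma \<open>weak_deriv_AE_eq\<close>).\<close>

section \<open>Smooth functions and bump functions\<close>

lemma C_k_Suc_imp: "C_k (Suc k) \<phi> \<Longrightarrow> C_k k \<phi>"
proof (induction k arbitrary: \<phi>)
  case 0
  then have "\<And>z. \<phi> differentiable (at z)"
    by (simp only: C_k.simps)
  then have "continuous_on UNIV \<phi>"
    by (meson continuous_at_imp_continuous_on differentiable_imp_continuous_within)
  then show ?case by (simp only: C_k.simps)
next
  case (Suc k)
  then show ?case by (metis C_k.simps(2))
qed

lemma C_k_continuous: "C_k k \<phi> \<Longrightarrow> continuous_on UNIV \<phi>"
proof (induction k)
  case (Suc k)
  then show ?case by (blast dest: C_k_Suc_imp)
qed simp

lemma C_k_const: "C_k k (\<lambda>z. c)"
proof (induction k arbitrary: c)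
  case (Suc k)
  have "dir_deriv v (\<lambda>z. c) = (\<lambda>z. 0)" for v
    by (auto simp: dir_deriv_def)
  with Suc show ?case by simp
qed simp

lemma C_k_add: "C_k k \<phi> \<Longrightarrow> C_k k \<psi> \<Longrightarrow> C_k k (\<lambda>z. \<phi> z + \<psi> z)"
proof (induction k arbitrary: \<phi> \<psi>)
  case (Suc k)
  have "dir_deriv v (\<lambda>z. \<phi> z + \<psi> z) = (\<lambda>z. dir_deriv v \<phi> z + dir_deriv v \<psi> z)" for v
  proof
    fix z
    have "((\<lambda>z. \<phi> z + \<psi> z) has_derivative
        (\<lambda>v. frechet_derivative \<phi> (at z) v + frechet_derivative \<psi> (at z) v)) (at z)"
      using Suc.prems by (auto intro!: has_derivative_add simp: frechet_derivative_works)
    from frechet_derivative_at[OF this]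
    show "dir_deriv v (\<lambda>z. \<phi> z + \<psi> z) z = dir_deriv v \<phi> z + dir_deriv v \<psi> z"
      by (metis dir_deriv_def)
  qed
  with Suc show ?case by (auto intro: differentiable_add)
qed (auto intro: continuous_intros)

lemma C_k_mult: "C_k k \<phi> \<Longrightarrow> C_k k \<psi> \<Longrightarrow> C_k k (\<lambda>z. \<phi> z * \<psi> z)"
proof (induction k arbitrary: \<phi> \<psi>)
  case (Suc k)
  have "dir_deriv v (\<lambda>z. \<phi> z * \<psi> z) = (\<lambda>z. \<phi> z * dir_deriv v \<psi> z + dir_deriv v \<phi> z * \<psi> z)" for v
  proof
    fix z
    have "((\<lambda>z. \<phi> z * \<psi> z) has_derivative
        (\<lambda>v. \<phi> z * frechet_derivative \<psi> (at z) v + frechet_derivative \<phi> (at z) v * \<psi> z)) (at z)"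
      using Suc.prems by (auto intro!: has_derivative_mult simp: frechet_derivative_works)
    from frechet_derivative_at[OF this]
    show "dir_deriv v (\<lambda>z. \<phi> z * \<psi> z) z = \<phi> z * dir_deriv v \<psi> z + dir_deriv v \<phi> z * \<psi> z"
      by (metis dir_deriv_def)
  qed
  moreover have "C_k k \<phi>" "C_k k \<psi>"
    using Suc.prems C_k_Suc_imp by blast+
  ultimately show ?case
    using Suc by (auto intro: differentiable_mult C_k_add)
qed (auto intro: continuous_intros)

lemma C_k_diff: "C_k k \<phi> \<Longrightarrow> C_k k \<psi> \<Longrightarrow> C_k k (\<lambda>z. \<phi> z - \<psi> z)"
  using C_k_add[OF _ C_k_mult[OF C_k_const[of k "-1"]], of \<phi> \<psi>] by simp

lemma C_k_bounded_linear:
  assumes "bounded_linear \<phi>"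
  shows "C_k k \<phi>"
proof (cases k)
  case 0
  then show ?thesis using assms by (simp add: linear_continuous_on)
next
  case (Suc k')
  have d: "(\<phi> has_derivative \<phi>) (at z)" for z
    using assms by (rule bounded_linear_imp_has_derivative)
  have "dir_deriv v \<phi> = (\<lambda>z. \<phi> v)" for v
    using frechet_derivative_at[OF d] by (auto simp: dir_deriv_def)
  with Suc d show ?thesis by (auto simp: C_k_const intro: differentiableI)
qed

text \<open>The outer function comes as a member of a family \<open>s\<close> that is closed under differentiation, with \<open>d\<close>
  giving the index of the derivative. This lets the induction on the order of smoothness run over all
  members at once, without iterated derivatives of functions of one variable.\<close>

lemma C_k_compose:
  fixes s :: "'i \<Rightarrow> real \<Rightarrow> real"
  assumes s: "\<And>i t. (s i has_real_derivative s (d i) t) (at t)"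
  shows "C_k k \<phi> \<Longrightarrow> C_k k (\<lambda>z. s i (\<phi> z))"
proof (induction k arbitrary: i)
  case 0
  have "continuous_on UNIV (s i)"
    using s by (meson DERIV_continuous continuous_at_imp_continuous_on)
  with 0 show ?case by (auto intro: continuous_on_compose2)
next
  case (Suc k)
  have \<phi>: "(\<phi> has_derivative frechet_derivative \<phi> (at z)) (at z)" for z
    using Suc.prems by (simp add: frechet_derivative_works)
  have D: "((\<lambda>z. s i (\<phi> z)) has_derivative (\<lambda>v. s (d i) (\<phi> z) * frechet_derivative \<phi> (at z) v)) (at z)" for z
    using has_derivative_compose[OF \<phi> s[unfolded has_field_derivative_def]] by (simp add: o_def)
  have "dir_deriv v (\<lambda>z. s i (\<phi> z)) = (\<lambda>z. s (d i) (\<phi> z) * dir_deriv v \<phi> z)" for v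
    using frechet_derivative_at[OF D] by (metis dir_deriv_def)
  moreover have "C_k k \<phi>" using Suc.prems C_k_Suc_imp by blast
  ultimately show ?case
    using Suc D by (auto intro!: C_k_mult differentiableI)
qed

text \<open>Cauchy's flat function, with a polynomial factor in \<open>1 / t\<close> so that differentiation
  stays inside the family: it replaces \<open>P\<close> by \<open>X\<^sup>2 (P - P')\<close>.\<close>

definition flat_exp :: "real poly \<Rightarrow> real \<Rightarrow> real" where
  "flat_exp P t = (if t \<le> 0 then 0 else poly P (1 / t) * exp (- (1 / t)))"

lemma poly_times_exp_minus_tendsto_0:
  fixes P :: "real poly"
  shows "((\<lambda>u. u ^ n * poly P u * exp (- u)) \<longlongrightarrow> 0) at_top"
proof (induction P arbitrary: n)
  case (pCons a P)
  have "((\<lambda>u::real. a * (u ^ n / exp u) + u ^ Suc n * poly P u * exp (- u)) \<longlongrightarrow> a * 0 + 0) at_top"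
    by (intro tendsto_intros tendsto_power_div_exp_0 pCons.IH)
  moreover have "(\<lambda>u::real. a * (u ^ n / exp u) + u ^ Suc n * poly P u * exp (- u)) =
      (\<lambda>u. u ^ n * poly (pCons a P) u * exp (- u))"
    by (auto simp: exp_minus field_simps)
  ultimately show ?case by simp
qed simp

lemma has_real_derivative_flat_exp:
  "(flat_exp P has_real_derivative flat_exp ([:0, 0, 1:] * (P - pderiv P)) t) (at t)"
proof -
  let ?Q = "[:0, 0, 1:] * (P - pderiv P)"
  consider "t < 0" | "t > 0" | "t = 0" by linarith
  then show ?thesis
  proof cases
    case 1
    have "((\<lambda>_. 0) has_real_derivative 0) (at t)" by simp
    then have "(flat_exp P has_real_derivative 0) (at t)"
      by (rule has_field_derivative_transform_within_open[of _ _ _ "{..<0}"])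
        (use 1 in \<open>auto simp: flat_exp_def\<close>)
    with 1 show ?thesis by (simp add: flat_exp_def)
  next
    case 2
    have "((\<lambda>t. poly P (1 / t) * exp (- (1 / t))) has_real_derivative
        poly ?Q (1 / t) * exp (- (1 / t))) (at t)"
      using 2 by (auto intro!: derivative_eq_intros simp: field_simps power2_eq_square)
    then have "(flat_exp P has_real_derivative poly ?Q (1 / t) * exp (- (1 / t))) (at t)"
      by (rule has_field_derivative_transform_within_open[of _ _ _ "{0<..}"])
        (use 2 in \<open>auto simp: flat_exp_def\<close>)
    with 2 show ?thesis by (simp add: flat_exp_def)
  next
    case 3
    have "((\<lambda>t. flat_exp P t / t) \<longlongrightarrow> 0) (at_right 0)"
    proof -
      have "((\<lambda>t::real. (inverse t) ^ 1 * poly P (inverse t) * exp (- inverse t)) \<longlongrightarrow> 0) (at_right 0)"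
        by (rule filterlim_compose[OF poly_times_exp_minus_tendsto_0 filterlim_inverse_at_top_right])
      then show ?thesis
        by (rule tendsto_cong[THEN iffD1, rotated])
          (auto simp: eventually_at_right_field flat_exp_def field_simps intro!: exI[of _ 1])
    qed
    moreover have "((\<lambda>t. flat_exp P t / t) \<longlongrightarrow> 0) (at_left 0)"
      by (rule tendsto_cong[THEN iffD1, OF _ tendsto_const])
        (auto simp: eventually_at_left_field flat_exp_def intro!: exI[of _ "-1"])
    ultimately have "((\<lambda>t. flat_exp P t / t) \<longlongrightarrow> 0) (at 0)"
      by (simp add: filterlim_at_split)
    with 3 show ?thesis
      by (simp add: has_field_derivative_iff flat_exp_def)
  qed
qed

definition soft_step :: "real \<Rightarrow> real" where "soft_step = flat_exp 1"

lemma soft_step_nonpos [simp]: "t \<le> 0 \<Longrightarrow> soft_step t = 0"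
  and soft_step_pos [simp]: "t > 0 \<Longrightarrow> soft_step t > 0"
  and soft_step_nonneg [simp]: "0 \<le> soft_step t"
  and soft_step_le_1 [simp]: "soft_step t \<le> 1"
  by (auto simp: soft_step_def flat_exp_def)

lemma C_k_soft_step: "C_k k \<phi> \<Longrightarrow> C_k k (\<lambda>z. soft_step (\<phi> z))"
  unfolding soft_step_def by (rule C_k_compose[where s = flat_exp and d = "\<lambda>P. [:0, 0, 1:] * (P - pderiv P)" and i = 1])
     (rule has_real_derivative_flat_exp)

text \<open>Rescaling the argument is enough to approximate the indicator of the positive half-line, because
  \<open>soft_step\<close> tends to \<open>1\<close> at infinity and vanishes on the negative half-line.\<close>

lemma soft_step_mult_tendsto:
  "(\<lambda>n. soft_step (real n * t)) \<longlonglongrightarrow> indicator {0<..} t"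
proof (cases "t > 0")
  case True
  have "(\<lambda>n. exp (- (inverse (real n) * inverse t))) \<longlonglongrightarrow> exp (- (0 * inverse t))"
    by (intro tendsto_intros lim_inverse_n)
  moreover have "eventually (\<lambda>n. exp (- (inverse (real n) * inverse t)) = soft_step (real n * t)) sequentially"
    using eventually_gt_at_top[of 0] 
  proof eventually_elim
    case (elim n)
    with True have "\<not> real n * t \<le> 0" by (simp add: not_le)
    then show ?case by (simp add: soft_step_def flat_exp_def inverse_eq_divide)
  qed
  ultimately have "(\<lambda>n. soft_step (real n * t)) \<longlonglongrightarrow> exp (- (0 * inverse t))"
    by (rule Lim_transform_eventually)
  with True show ?thesis by simp
next
  case False
  then have "soft_step (real n * t) = 0" for n
    by (intro soft_step_nonpos) (auto simp: mult_le_0_iff)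
  with False show ?thesis by simp
qed

section \<open>The fundamental lemma of the calculus of variations\<close>

lemma soft_box_tendsto:
  fixes a b z :: complex
  shows "(\<lambda>n. soft_step (real n * (Re z - Re a)) * soft_step (real n * (Re b - Re z)) *
        (soft_step (real n * (Im z - Im a)) * soft_step (real n * (Im b - Im z))))
      \<longlonglongrightarrow> indicator (box a b) z"
proof -
  have "indicat_real (box a b) z = indicator {0<..} (Re z - Re a) * indicator {0<..} (Re b - Re z) *
      (indicator {0<..} (Im z - Im a) * indicator {0<..} (Im b - Im z))"
    by (auto simp: indicator_def box_def Basis_complex_def)
  then show ?thesis
    by (simp only:) (intro tendsto_mult soft_step_mult_tendsto)
qed

text \<open>The fundamental lemma of the calculus of variations. Products of four soft steps converge boundedly to the
  indicator of a box, so the integral of \<open>k\<close> over every box vanishes; boxes generate the Borel sets and are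
  stable under intersection, so the same holds for all measurable sets.\<close>

lemma AE_zero_if_orthogonal_to_smooth:
  fixes k :: "complex \<Rightarrow> complex"
  assumes k: "integrable lebesgue k"
    and orth: "\<And>\<phi>. (\<And>j. C_k j \<phi>) \<Longrightarrow> (LINT z|lebesgue. \<phi> z *\<^sub>R k z) = 0"
  shows "AE z in lebesgue. k z = 0"
proof -
  interpret lebesgue: sigma_finite_measure "lebesgue :: complex measure"
    by standard (intro exI[of _ "range (\<lambda>n::nat. box (- real n *\<^sub>R One) (real n *\<^sub>R One))"],
        auto simp: emeasure_lborel_cbox_eq UN_box_eq_UNIV)
  have k_meas [measurable]: "k \<in> borel_measurable lebesgue"
    using k by simp
  have box: "(LINT z:box a b|lebesgue. k z) = 0" for a b
  proof -
    define \<phi> where "\<phi> n z = soft_step (real n * (Re z - Re a)) * soft_step (real n * (Re b - Re z)) *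
        (soft_step (real n * (Im z - Im a)) * soft_step (real n * (Im b - Im z)))" for n z
    have smooth: "C_k j (\<phi> n)" for j n
      unfolding \<phi>_def
      by (intro C_k_mult C_k_soft_step C_k_diff C_k_const C_k_bounded_linear
          bounded_linear_Re bounded_linear_Im)
    have [measurable]: "\<phi> n \<in> borel_measurable lebesgue" for n
      using C_k_continuous[OF smooth[of 0]]
      by (intro measurable_completion) (simp add: borel_measurable_continuous_onI)
    have \<phi>1: "\<bar>\<phi> n z\<bar> \<le> 1" for n z
      by (auto simp: \<phi>_def abs_mult intro!: mult_le_one)
    have "(\<lambda>n. LINT z|lebesgue. \<phi> n z *\<^sub>R k z) \<longlonglongrightarrow> (LINT z|lebesgue. indicator (box a b) z *\<^sub>R k z)"
    proof (rule integral_dominated_convergence[where w = "\<lambda>z. norm (k z)"])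
      show "AE z in lebesgue. (\<lambda>n. \<phi> n z *\<^sub>R k z) \<longlonglongrightarrow> indicator (box a b) z *\<^sub>R k z"
        unfolding \<phi>_def by (intro AE_I2 tendsto_scaleR soft_box_tendsto tendsto_const)
      show "AE z in lebesgue. norm (\<phi> n z *\<^sub>R k z) \<le> norm (k z)" for n
        using \<phi>1[of n] by (auto intro!: AE_I2 mult_left_le_one_le)
      show "(\<lambda>z. indicat_real (box a b) z *\<^sub>R k z) \<in> borel_measurable lebesgue"
        by (intro borel_measurable_scaleR borel_measurable_indicator k_meas) simp
    qed (use k in \<open>auto\<close>)
    then show ?thesis
      using orth[OF smooth] by (simp add: set_lebesgue_integral_def LIMSEQ_const_iff)
  qed
  have sub: "set_integrable lebesgue A k" if "A \<in> sets lebesgue" for A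
    unfolding set_integrable_def using that k by (rule integrable_mult_indicator)
  have total: "(LINT z|lebesgue. k z) = 0"
    using orth[OF C_k_const[of _ 1]] by simp
  let ?G = "range (\<lambda>(a, b). box a b :: complex set)"
  have borel: "(LINT z:A|lebesgue. k z) = 0" if "A \<in> sets borel" for A
  proof -
    have sets: "sets borel = sigma_sets UNIV ?G"
      unfolding borel_eq_box by simp
    have "Int_stable ?G"
      by (auto simp: Int_stable_def box_Int_box)
    moreover have "?G \<subseteq> Pow UNIV" by simp
    moreover have "A \<in> sigma_sets UNIV ?G"
      using that sets by simp
    ultimately show ?thesis
    proof (induction rule: sigma_sets_induct_disjoint)
      case (basic A)
      then show ?case using box by auto
    next
      case (compl A)
      then have A: "A \<in> sets lebesgue" "- A \<in> sets lebesgue"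
        using sets by (auto simp: Compl_in_sets_lebesgue)
      have "(LINT z:A \<union> - A|lebesgue. k z) = (LINT z:A|lebesgue. k z) + (LINT z:- A|lebesgue. k z)"
        using A by (intro set_integral_Un sub) auto
      with total compl show ?case
        by (simp add: Compl_eq_Diff_UNIV set_lebesgue_integral_def)
    next
      case (union A)
      then have "A i \<in> sets borel" for i
        using sets by blast
      then have "\<And>i. A i \<in> sets lebesgue"
        by simp
      with union show ?case
        by (subst lebesgue_integral_countable_add) (auto simp: disjoint_family_on_def intro!: sub)
    qed (simp add: set_lebesgue_integral_def)
  qed
  show ?thesis
  proof (rule lebesgue.density_zero[OF k])
    fix A :: "complex set" assume A: "A \<in> sets lebesgue"
    then obtain S N N' where S: "A = S \<union> N" "N \<subseteq> N'" "N' \<in> null_sets lborel" "S \<in> sets lborel"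
      by (rule sets_completionE)
    have "N' \<in> null_sets lebesgue"
      using S(3) by (rule null_sets_completionI)
    then have "AE z in lebesgue. z \<notin> N'"
      by (rule AE_not_in)
    then have "AE z in lebesgue. indicat_real A z *\<^sub>R k z = indicator S z *\<^sub>R k z"
      by eventually_elim (use S in \<open>auto simp: indicator_def\<close>)
    then have "(LINT z:A|lebesgue. k z) = (LINT z:S|lebesgue. k z)"
      unfolding set_lebesgue_integral_def
      using A sets_completionI_sets[OF S(4)]
      by (intro integral_cong_AE borel_measurable_scaleR borel_measurable_indicator k_meas)
    with borel S(4) show "(LINT z:A|lebesgue. k z) = 0" by simp
  qed
qed

section \<open>Integration of radial functions\<close>

lemma max_0_2pi_eq_indicator: "max 0 (2 * pi * r) = 2 * pi * (indicator {0<..} r * r)"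
proof (cases "0 < r")
  case True
  then have "0 \<le> 2 * pi * r" by simp
  with True show ?thesis by (subst max_absorb2) auto
next
  case False
  then have "2 * pi * r \<le> 0" by (simp add: mult_nonneg_nonpos)
  with False show ?thesis by (subst max_absorb1) auto
qed

text \<open>Polar coordinates for radial functions: the image of the area measure under the modulus is
  determined by the areas \<open>\<pi> r\<^sup>2\<close> of discs, whose derivative in \<open>r\<close> is the density. The maximum
  with \<open>0\<close> makes the density a nonnegative real function on the whole line.\<close>

lemma distr_norm_complex:
  "distr lborel borel (norm :: complex \<Rightarrow> real) = density lborel (\<lambda>r. ennreal (max 0 (2 * pi * r)))"
    (is "?M = ?N")
proof (rule measure_eqI_generator_eq)
  let ?E = "range (\<lambda>r::real. {..r})"
  have disc: "emeasure ?M {..r} = ennreal (pi * (max 0 r)\<^sup>2)" for r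
  proof (cases "0 \<le> r")
    case True
    have "norm -` {..r} = (cball 0 r :: complex set)"
      by (auto simp: cball_def dist_norm)
    then have "emeasure ?M {..r} = emeasure lborel (cball (0::complex) r)"
      by (simp add: emeasure_distr)
    with True show ?thesis
      by (simp add: emeasure_cball unit_ball_vol_2)
  next
    case False
    then have "norm -` {..r} = ({} :: complex set)"
      by (auto dest: order_trans[OF norm_ge_zero])
    with False show ?thesis by (simp add: emeasure_distr)
  qed
  have ring: "emeasure ?N {..r} = ennreal (pi * (max 0 r)\<^sup>2)" for r
  proof -
    have "emeasure ?N {..r} = (\<integral>\<^sup>+x. ennreal (max 0 (2 * pi * x)) * indicator {..r} x \<partial>lborel)"
      by (simp add: emeasure_density)
    also have "\<dots> = (\<integral>\<^sup>+x. ennreal (2 * pi * x) * indicator {0..max 0 r} x \<partial>lborel)"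
      unfolding max_0_2pi_eq_indicator by (intro nn_integral_cong) (auto simp: indicator_def)
    also have "\<dots> = ennreal (pi * (max 0 r)\<^sup>2 - pi * 0\<^sup>2)"
      by (rule nn_integral_FTC_Icc) (auto intro!: derivative_eq_intros)
    finally show ?thesis by simp
  qed
  show "Int_stable ?E" by (auto simp: Int_stable_def)
  show "emeasure ?M X = emeasure ?N X" if "X \<in> ?E" for X
    using that disc ring by auto
  show "sets ?M = sigma_sets UNIV ?E" "sets ?N = sigma_sets UNIV ?E"
    by (simp_all add: borel_eq_atMost)
  show "range (\<lambda>n. {..real n}) \<subseteq> ?E" by auto
  show "(\<Union>n. {..real n}) = UNIV" by (auto intro: real_arch_simple)
  show "emeasure ?M {..real n} \<noteq> \<infinity>" for n
    by (simp only: disc) simp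
qed simp

lemma integrable_radial_iff:
  fixes G :: "real \<Rightarrow> real"
  assumes [measurable]: "G \<in> borel_measurable borel"
  shows "integrable lborel (\<lambda>z::complex. G (norm z)) \<longleftrightarrow> set_integrable lborel {0<..} (\<lambda>r. r * G r)"
proof -
  have "integrable lborel (\<lambda>z::complex. G (norm z)) \<longleftrightarrow>
      integrable (distr lborel borel (norm :: complex \<Rightarrow> real)) G"
    by (simp add: integrable_distr_eq)
  also have "\<dots> \<longleftrightarrow> integrable lborel (\<lambda>r. max 0 (2 * pi * r) *\<^sub>R G r)"
    unfolding distr_norm_complex by (intro integrable_density) auto
  also have "(\<lambda>r. max 0 (2 * pi * r) *\<^sub>R G r) = (\<lambda>r. (2 * pi) * (indicator {0<..} r *\<^sub>R (r * G r)))"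
    by (auto simp: max_0_2pi_eq_indicator)
  finally show ?thesis
    by (simp add: set_integrable_def)
qed

lemma integral_radial:
  fixes G :: "real \<Rightarrow> real"
  assumes [measurable]: "G \<in> borel_measurable borel"
  shows "(LINT z|lborel. G (norm (z::complex))) = 2 * pi * (LINT r:{0<..}|lborel. r * G r)"
proof -
  have "(LINT z|lborel. G (norm (z::complex))) =
      integral\<^sup>L (distr lborel borel (norm :: complex \<Rightarrow> real)) G"
    by (simp add: integral_distr)
  also have "\<dots> = (LINT r|lborel. max 0 (2 * pi * r) *\<^sub>R G r)"
    unfolding distr_norm_complex by (intro integral_density) auto
  also have "(\<lambda>r. max 0 (2 * pi * r) *\<^sub>R G r) = (\<lambda>r. (2 * pi) * (indicator {0<..} r *\<^sub>R (r * G r)))"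
    by (auto simp: max_0_2pi_eq_indicator)
  finally show ?thesis
    by (simp add: set_lebesgue_integral_def)
qed

lemma AE_radial:
  assumes "AE r in lborel. 0 < r \<longrightarrow> P r"
  shows "AE z in lborel. (z::complex) \<noteq> 0 \<longrightarrow> P (norm z)"
proof -
  have "AE r in distr lborel borel (norm :: complex \<Rightarrow> real). P r"
    unfolding distr_norm_complex using assms by (simp add: AE_density less_max_iff_disj zero_less_mult_iff)
  then show ?thesis
    by (auto dest!: AE_distrD[rotated])
qed

section \<open>Lipschitz functions and their derivatives on the half-line\<close>

lemma compact_continuous_bound:
  fixes f :: "'a::topological_space \<Rightarrow> 'b::real_normed_vector"
  assumes "compact K" "continuous_on K f"
  obtains B where "0 \<le> B" "\<And>x. x \<in> K \<Longrightarrow> norm (f x) \<le> B"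
proof -
  have "bounded (f ` K)"
    using assms by (intro compact_imp_bounded compact_continuous_image)
  then obtain B where B: "\<forall>x\<in>K. norm (f x) \<le> B" by (auto simp: bounded_iff)
  show ?thesis
    by (rule that[of "\<bar>B\<bar>"]) (use B in \<open>auto intro: order_trans\<close>)
qed

lemma lipschitz_on_Icc_mult:
  fixes f g :: "real \<Rightarrow> real"
  assumes f: "L-lipschitz_on {a..b} f" and g: "M-lipschitz_on {a..b} g"
  shows "\<exists>N. N-lipschitz_on {a..b} (\<lambda>r. f r * g r)"
proof -
  obtain A where A: "0 \<le> A" "\<And>r. r \<in> {a..b} \<Longrightarrow> norm (f r) \<le> A"
    using compact_continuous_bound[OF compact_Icc lipschitz_on_continuous_on[OF f]] by blast
  obtain B where B: "0 \<le> B" "\<And>r. r \<in> {a..b} \<Longrightarrow> norm (g r) \<le> B"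
    using compact_continuous_bound[OF compact_Icc lipschitz_on_continuous_on[OF g]] by blast
  have "(A * M + B * L)-lipschitz_on {a..b} (\<lambda>r. f r * g r)"
  proof (rule lipschitz_onI)
    fix r s assume rs: "r \<in> {a..b}" "s \<in> {a..b}"
    have "\<bar>f r * g r - f s * g s\<bar> = \<bar>f r * (g r - g s) + g s * (f r - f s)\<bar>"
      by (simp add: algebra_simps)
    also have "\<dots> \<le> \<bar>f r\<bar> * \<bar>g r - g s\<bar> + \<bar>g s\<bar> * \<bar>f r - f s\<bar>"
      using abs_triangle_ineq[of "f r * (g r - g s)" "g s * (f r - f s)"] by (simp add: abs_mult)
    also have "\<dots> \<le> A * (M * \<bar>r - s\<bar>) + B * (L * \<bar>r - s\<bar>)"
      using lipschitz_onD[OF f rs] lipschitz_onD[OF g rs] A B rs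
      by (intro add_mono mult_mono) (simp_all add: dist_real_def)
    finally show "dist (f r * g r) (f s * g s) \<le> (A * M + B * L) * dist r s"
      by (simp add: dist_real_def algebra_simps)
  next
    show "0 \<le> A * M + B * L"
      using A B lipschitz_on_nonneg[OF f] lipschitz_on_nonneg[OF g] by simp
  qed
  then show ?thesis by blast
qed

lemma C1_lipschitz_on_Icc:
  fixes f f' :: "real \<Rightarrow> real"
  assumes deriv: "\<And>x. x \<in> {a..b} \<Longrightarrow> (f has_real_derivative f' x) (at x)"
    and cont: "continuous_on {a..b} f'"
  shows "\<exists>L. L-lipschitz_on {a..b} f"
proof -
  obtain B where B: "0 \<le> B" "\<And>x. x \<in> {a..b} \<Longrightarrow> norm (f' x) \<le> B"
    using compact_continuous_bound[OF compact_Icc cont] by blast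
  have "B-lipschitz_on {a..b} f"
  proof (rule lipschitz_onI)
    fix x y assume "x \<in> {a..b}" "y \<in> {a..b}"
    then have "norm (f x - f y) \<le> B * norm (x - y)"
      using B(2) by (intro field_differentiable_bound[where S = "{a..b}" and f' = f'])
        (simp_all add: has_field_derivative_at_within[OF deriv])
    then show "dist (f x) (f y) \<le> B * dist x y"
      by (simp add: dist_real_def)
  qed (rule B(1))
  then show ?thesis by blast
qed

text \<open>The fundamental theorem of calculus for a Lipschitz function whose derivative is known almost everywhere.
  The difference quotients are bounded by the Lipschitz constant and converge almost everywhere, so
  their integrals converge to the integral of the derivative. By translation these integrals are
  differences of means of \<open>F\<close> over short intervals at \<open>b\<close> and at \<open>a\<close>, which converge by continuity. The margin
  between \<open>b\<close> and \<open>c\<close> leaves room for the translation.\<close>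

lemma lipschitz_integral_derivative:
  fixes F :: "real \<Rightarrow> real"
  assumes ab: "a \<le> b" "b < c" and lip: "L-lipschitz_on {a..c} F"
    and D [measurable]: "D \<in> borel_measurable borel"
    and deriv: "AE r in lborel. r \<in> {a..b} \<longrightarrow> (F has_real_derivative D r) (at r)"
  shows "(LINT r:{a..b}|lborel. D r) = F b - F a"
proof -
  have cont: "continuous_on {a..c} F"
    using lip by (rule lipschitz_on_continuous_on)
  define h where "h n = (c - b) / (real n + 1)" for n
  have h0: "0 < h n" "b + h n \<le> c" for n
    using ab mult_left_mono[of 1 "real n + 1" "c - b"] by (auto simp: h_def field_simps)
  have h_lim: "h \<longlonglongrightarrow> 0"
    unfolding h_def by real_asymp
  have h_at: "filterlim h (at 0) sequentially"
    using h_lim h0(1) by (auto simp: filterlim_at less_imp_neq[symmetric])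
  define q where "q n r = (F (r + h n) - F r) / h n" for n r
  have q_lim: "(\<lambda>n. LINT r:{a..b}|lborel. q n r) \<longlonglongrightarrow> (LINT r:{a..b}|lborel. D r)"
    unfolding set_lebesgue_integral_def
  proof (rule integral_dominated_convergence[where w = "\<lambda>r. indicator {a..b} r * L"])
    show "(\<lambda>r. indicat_real {a..b} r *\<^sub>R D r) \<in> borel_measurable lborel" by simp
    show "(\<lambda>r. indicat_real {a..b} r *\<^sub>R q n r) \<in> borel_measurable lborel" for n
    proof -
      have "continuous_on {a..b} (q n)"
        unfolding q_def using h0[of n]
        by (intro continuous_intros continuous_on_compose2[OF cont]) auto
      then show ?thesis
        using borel_measurable_continuous_on_indicator[of "{a..b}" "q n"] by simp
    qed
    show "integrable lborel (\<lambda>r. indicat_real {a..b} r * L)"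
      by (intro integrable_mult_left integrable_real_indicator)
        (auto simp: emeasure_lborel_Icc_eq)
    show "AE r in lborel. (\<lambda>n. indicat_real {a..b} r *\<^sub>R q n r) \<longlonglongrightarrow> indicat_real {a..b} r *\<^sub>R D r"
      using deriv
    proof eventually_elim
      case (elim r)
      show ?case
      proof (cases "r \<in> {a..b}")
        case True
        with elim have "((\<lambda>k. (F (r + k) - F r) / k) \<longlongrightarrow> D r) (at 0)"
          by (simp add: DERIV_def)
        then have "(\<lambda>n. q n r) \<longlonglongrightarrow> D r"
          unfolding q_def using h_at by (rule filterlim_compose)
        with True show ?thesis by simp
      qed simp
    qed
    show "AE r in lborel. norm (indicat_real {a..b} r *\<^sub>R q n r) \<le> indicat_real {a..b} r * L" for n
    proof (intro AE_I2)
      fix r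
      have "\<bar>F (r + h n) - F r\<bar> \<le> L * h n" if "r \<in> {a..b}"
        using lipschitz_onD[OF lip, of "r + h n" r] that h0[of n] by (auto simp: dist_real_def)
      then show "norm (indicat_real {a..b} r *\<^sub>R q n r) \<le> indicat_real {a..b} r * L"
        using h0[of n] by (auto simp: indicator_def q_def field_simps)
    qed
  qed
  define G where "G x = integral {a..x} F" for x
  have G: "(G has_real_derivative F t) (at t within {a..c})" if "t \<in> {a..c}" for t
    unfolding G_def using cont that by (rule integral_has_real_derivative)
  have quot: "(\<lambda>n. (G (t + h n) - G t) / h n) \<longlonglongrightarrow> F t" if "t \<in> {a..b}" for t
  proof -
    have "((\<lambda>y. (G y - G t) / (y - t)) \<longlongrightarrow> F t) (at t within {a..c})"
      using G that ab by (simp add: has_field_derivative_iff)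
    moreover have "filterlim (\<lambda>n. t + h n) (at t within {a..c}) sequentially"
      unfolding filterlim_at
    proof
      show "\<forall>\<^sub>F n in sequentially. t + h n \<in> {a..c} \<and> t + h n \<noteq> t"
      proof (intro always_eventually allI)
        fix n show "t + h n \<in> {a..c} \<and> t + h n \<noteq> t"
          using h0[of n] that by auto
      qed
      show "(\<lambda>n. t + h n) \<longlonglongrightarrow> t"
        using tendsto_add[OF tendsto_const h_lim, of t] by simp
    qed
    ultimately have "(\<lambda>n. (G (t + h n) - G t) / (t + h n - t)) \<longlonglongrightarrow> F t"
      by (rule filterlim_compose)
    then show ?thesis by simp
  qed
  have "(LINT r:{a..b}|lborel. q n r) = (G (b + h n) - G b) / h n - (G (a + h n) - G a) / h n" for n
  proof -
    have c1: "continuous_on {a..b} (\<lambda>r. F (r + h n))"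
      using h0[of n] by (intro continuous_on_compose2[OF cont] continuous_intros) auto
    have c2: "continuous_on {a..b} F" "continuous_on {a + h n..b + h n} F" "continuous_on {a..b + h n} F"
      using h0[of n] ab by (auto intro: continuous_on_subset[OF cont])
    have cq: "continuous_on {a..b} (q n)"
      unfolding q_def using h0[of n] by (intro continuous_intros c1 c2) auto
    have "(LINT r:{a..b}|lborel. q n r) = integral {a..b} (q n)"
      using cq by (intro set_borel_integral_eq_integral borel_integrable_atLeastAtMost')
    also have "\<dots> = (integral {a..b} (\<lambda>r. F (r + h n)) - integral {a..b} F) / h n"
      unfolding q_def integral_divide using c1 c2
      by (subst integral_diff) (auto intro: integrable_continuous_real)
    also have "integral {a..b} (\<lambda>r. F (r + h n)) = integral {a + h n..b + h n} F"
      using integral_shift[OF c2(2)] by (simp add: o_def)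
    also have "\<dots> = G (b + h n) - G (a + h n)"
    proof -
      have "integral {a..a + h n} F + integral {a + h n..b + h n} F = integral {a..b + h n} F"
        using h0[of n] ab
        by (intro Henstock_Kurzweil_Integration.integral_combine integrable_continuous_real c2) auto
      then show ?thesis by (simp add: G_def)
    qed
    also have "integral {a..b} F = G b - G a"
      by (simp add: G_def)
    finally show ?thesis by (simp add: diff_divide_distrib)
  qed
  moreover have "(\<lambda>n. (G (b + h n) - G b) / h n - (G (a + h n) - G a) / h n) \<longlonglongrightarrow> F b - F a"
    using ab by (intro tendsto_diff quot) auto
  ultimately show ?thesis
    using q_lim LIMSEQ_unique by simp
qed

text \<open>If \<open>\<bar>F\<bar> \<ge> \<epsilon>\<close> held on all of \<open>{a..b}\<close>, then the integral of \<open>\<bar>F r / r\<bar>\<close> over it would be at least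
  \<open>\<epsilon> (ln b - ln a)\<close>. So \<open>F\<close> is small somewhere in every interval that is long in the
  logarithmic scale, and such intervals fit near \<open>0\<close> as well as near \<open>\<infinity>\<close>.\<close>

lemma integral_derivative_half_line_eq_0:
  fixes F :: "real \<Rightarrow> real"
  assumes lip: "\<And>a b. 0 < a \<Longrightarrow> \<exists>L. L-lipschitz_on {a..b} F"
    and D [measurable]: "D \<in> borel_measurable borel"
    and deriv: "AE r in lborel. 0 < r \<longrightarrow> (F has_real_derivative D r) (at r)"
    and int_D: "set_integrable lborel {0<..} D"
    and int_F: "set_integrable lborel {0<..} (\<lambda>r. F r / r)"
  shows "(LINT r:{0<..}|lborel. D r) = 0"
proof -
  define I where "I = (LINT r:{0<..}|lborel. \<bar>F r / r\<bar>)"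
  have small: "\<exists>r\<in>{a..b}. \<bar>F r\<bar> < \<epsilon>" if "0 < a" "a \<le> b" "0 < \<epsilon>" "I < \<epsilon> * (ln b - ln a)" for a b \<epsilon>
  proof (rule ccontr)
    assume "\<not> ?thesis"
    then have large: "\<And>r. r \<in> {a..b} \<Longrightarrow> \<epsilon> \<le> \<bar>F r\<bar>" by force
    have abs: "set_integrable lborel {0<..} (\<lambda>r. \<bar>F r / r\<bar>)"
      using int_F by (rule set_integrable_abs)
    have sub: "set_integrable lborel {a..b} (\<lambda>r. \<bar>F r / r\<bar>)"
      using abs \<open>0 < a\<close> by (elim set_integrable_subset) auto
    have "\<epsilon> * (ln b - ln a) = \<epsilon> * ln b - \<epsilon> * ln a" by (simp add: algebra_simps)
    also have "\<dots> = (LINT r:{a..b}|lborel. \<epsilon> / r)"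
      unfolding set_lebesgue_integral_def using that(1,2)
      by (intro integral_FTC_atLeastAtMost[symmetric])
        (auto intro!: derivative_eq_intros continuous_intros
          simp: has_real_derivative_iff_has_vector_derivative[symmetric])
    also have "\<dots> \<le> (LINT r:{a..b}|lborel. \<bar>F r / r\<bar>)"
      using that(1) large
      by (intro set_integral_mono sub borel_integrable_atLeastAtMost')
        (auto intro!: continuous_intros divide_right_mono)
    also have "\<dots> \<le> I"
      unfolding I_def set_lebesgue_integral_def
      using abs sub that(1) unfolding set_integrable_def
      by (intro integral_mono) (auto simp: indicator_def)
    finally show False using that(4) by simp
  qed
  define \<epsilon> where "\<epsilon> n = 1 / (real n + 1)" for n
  have \<epsilon>_pos: "0 < \<epsilon> n" for n by (simp add: \<epsilon>_def)
  \<comment> \<open>the ratio of the end points that forces a value below \<open>\<epsilon> n\<close>\<close>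
  define T where "T n = exp (\<bar>I\<bar> / \<epsilon> n + 1)" for n
  have T1: "1 < T n" for n using \<epsilon>_pos[of n] by (simp add: T_def add_nonneg_pos)
  have IT: "I < \<epsilon> n * ln (T n)" for n
  proof -
    have "\<epsilon> n * ln (T n) = \<bar>I\<bar> + \<epsilon> n"
      using \<epsilon>_pos[of n] by (simp add: T_def distrib_left)
    with \<epsilon>_pos[of n] show ?thesis by simp
  qed
  have "\<forall>n. \<exists>r\<in>{\<epsilon> n / T n..\<epsilon> n}. \<bar>F r\<bar> < \<epsilon> n"
  proof
    fix n show "\<exists>r\<in>{\<epsilon> n / T n..\<epsilon> n}. \<bar>F r\<bar> < \<epsilon> n"
      using \<epsilon>_pos[of n] T1[of n] IT[of n]
      by (intro small) (auto simp: ln_div field_simps)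
  qed
  then obtain a where a: "\<And>n. a n \<in> {\<epsilon> n / T n..\<epsilon> n}" "\<And>n. \<bar>F (a n)\<bar> < \<epsilon> n" by metis
  have "\<forall>n. \<exists>r\<in>{real n + 1..(real n + 1) * T n}. \<bar>F r\<bar> < \<epsilon> n"
  proof
    fix n show "\<exists>r\<in>{real n + 1..(real n + 1) * T n}. \<bar>F r\<bar> < \<epsilon> n"
      using \<epsilon>_pos[of n] T1[of n] IT[of n] mult_left_mono[of 1 "T n" "real n + 1"]
      by (intro small) (auto simp: ln_mult simp del: of_nat_Suc)
  qed
  then obtain b where b: "\<And>n. b n \<in> {real n + 1..(real n + 1) * T n}" "\<And>n. \<bar>F (b n)\<bar> < \<epsilon> n" by metis
  have a_pos: "0 < a n" for n
    using a(1)[of n] \<epsilon>_pos[of n] T1[of n] by (smt (verit) atLeastAtMost_iff divide_pos_pos)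
  have \<epsilon>_lim: "\<epsilon> \<longlonglongrightarrow> 0" unfolding \<epsilon>_def by real_asymp
  have ab: "a n \<le> b n" for n
  proof -
    have "a n \<le> \<epsilon> n" using a(1)[of n] by auto
    also have "\<epsilon> n \<le> 1" by (simp add: \<epsilon>_def)
    also have "1 \<le> b n" using b(1)[of n] by auto
    finally show ?thesis .
  qed
  have "(LINT r:{a n..b n}|lborel. D r) = F (b n) - F (a n)" for n
  proof -
    obtain L where "L-lipschitz_on {a n..b n + 1} F" using lip[OF a_pos] by blast
    then show ?thesis
      using ab deriv a_pos[of n] by (intro lipschitz_integral_derivative[where c = "b n + 1"]) (auto elim: eventually_mono)
  qed
  moreover have "(\<lambda>n. F (b n) - F (a n)) \<longlonglongrightarrow> 0 - 0"
  proof (intro tendsto_diff)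
    show "(\<lambda>n. F (b n)) \<longlonglongrightarrow> 0"
      by (rule Lim_null_comparison[OF _ \<epsilon>_lim]) (use b(2) in \<open>simp add: less_imp_le\<close>)
    show "(\<lambda>n. F (a n)) \<longlonglongrightarrow> 0"
      by (rule Lim_null_comparison[OF _ \<epsilon>_lim]) (use a(2) in \<open>simp add: less_imp_le\<close>)
  qed
  moreover have "(\<lambda>n. LINT r:{a n..b n}|lborel. D r) \<longlonglongrightarrow> (LINT r:{0<..}|lborel. D r)"
    unfolding set_lebesgue_integral_def
  proof (rule integral_dominated_convergence[where w = "\<lambda>r. norm (indicator {0<..} r *\<^sub>R D r)"])
    show "integrable lborel (\<lambda>r. norm (indicat_real {0<..} r *\<^sub>R D r))"
      using int_D unfolding set_integrable_def by (rule integrable_norm)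
    show "AE r in lborel. norm (indicat_real {a n..b n} r *\<^sub>R D r) \<le> norm (indicat_real {0<..} r *\<^sub>R D r)" for n
      using a_pos[of n] by (auto simp: indicator_def)
    show "AE r in lborel. (\<lambda>n. indicat_real {a n..b n} r *\<^sub>R D r) \<longlonglongrightarrow> indicat_real {0<..} r *\<^sub>R D r"
    proof (intro AE_I2 tendsto_eventually)
      fix r
      show "\<forall>\<^sub>F n in sequentially. indicat_real {a n..b n} r *\<^sub>R D r = indicat_real {0<..} r *\<^sub>R D r"
      proof (cases "0 < r")
        case True
        have "\<forall>\<^sub>F n in sequentially. \<epsilon> n < r"
          using \<epsilon>_lim True by (rule order_tendstoD)
        moreover have "\<forall>\<^sub>F n in sequentially. r \<le> real n"
          using eventually_ge_at_top[of "nat \<lceil>r\<rceil>"] by eventually_elim linarith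
        ultimately show ?thesis
        proof eventually_elim
          case (elim n)
          with a(1)[of n] b(1)[of n] have "r \<in> {a n..b n}" by auto
          with True show ?case by simp
        qed
      next
        case False
        with a_pos have "r \<notin> {a n..b n}" for n by (metis atLeastAtMost_iff less_le_trans)
        with False show ?thesis by simp
      qed
    qed
  qed auto
  ultimately show ?thesis
    using LIMSEQ_unique by fastforce
qed

section \<open>Integration by parts\<close>

lemma lborel_integral_translation:
  fixes g :: "'a::euclidean_space \<Rightarrow> 'b::{banach, second_countable_topology}"
  assumes "g \<in> borel_measurable borel"
  shows "(LINT z|lborel. g (c + z)) = (LINT z|lborel. g z)"
proof -
  have "(LINT z|lborel. g z) = (LINT z|distr lborel borel ((+) c). g z)"
    by (simp only: lborel_distr_plus)
  also have "\<dots> = (LINT z|lborel. g (c + z))"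
    using assms by (intro integral_distr) auto
  finally show ?thesis by simp
qed

lemma integrable_continuous_compact_support:
  fixes g :: "'a::euclidean_space \<Rightarrow> 'b::{banach, second_countable_topology}"
  assumes "continuous_on UNIV g" "compact K" "\<And>z. z \<notin> K \<Longrightarrow> g z = 0"
  shows "integrable lborel g"
proof -
  have "integrable lborel (\<lambda>z. indicator K z *\<^sub>R g z)"
    using assms by (intro borel_integrable_compact) (auto intro: continuous_on_subset)
  moreover have "(\<lambda>z. indicator K z *\<^sub>R g z) = g"
    using assms(3) by (auto simp: indicator_def fun_eq_iff)
  ultimately show ?thesis by simp
qed

lemma has_real_derivative_along_line:
  assumes "C_k (Suc k) \<phi>" and v: "v = 1 \<or> v = \<i>"
  shows "((\<lambda>s. \<phi> (z + of_real s * v)) has_real_derivative dir_deriv v \<phi> (z + of_real s * v)) (at s)"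
proof -
  let ?D = "frechet_derivative \<phi> (at (z + of_real s * v))"
  have \<phi>: "(\<phi> has_derivative ?D) (at (z + of_real s * v))"
    using assms(1) by (simp add: frechet_derivative_works)
  have "((\<lambda>s. z + of_real s * v) has_derivative (\<lambda>t. of_real t * v)) (at s)"
    by (auto intro!: derivative_eq_intros)
  from has_derivative_compose[OF this \<phi>]
  have "((\<lambda>s. \<phi> (z + of_real s * v)) has_derivative (\<lambda>t. ?D (of_real t * v))) (at s)" .
  moreover have "?D (of_real t * v) = dir_deriv v \<phi> (z + of_real s * v) * t" for t
    using linear_cmul[OF has_derivative_linear[OF \<phi>], of t v]
    by (simp add: dir_deriv_def scaleR_conv_of_real)
  ultimately show ?thesis
    by (simp add: has_field_derivative_def)
qed

lemma has_vector_derivative_quotient: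
  assumes "((\<lambda>s. f (z + of_real s * v)) has_vector_derivative D) (at 0)"
  shows "((\<lambda>s::real. (f (z + of_real s * v) - f z) /\<^sub>R s) \<longlongrightarrow> D) (at 0)"
proof -
  have "((\<lambda>s. norm (f (z + of_real s * v) - f z - s *\<^sub>R D) / norm s) \<longlongrightarrow> 0) (at 0)"
    using assms by (simp add: has_vector_derivative_def has_derivative_iff_norm)
  moreover have "\<forall>\<^sub>F s in at (0::real). norm (f (z + of_real s * v) - f z - s *\<^sub>R D) / norm s =
      norm ((f (z + of_real s * v) - f z) /\<^sub>R s - D)"
    using eventually_neq_at_within[of 0]
  proof eventually_elim
    case (elim s)
    then have "(f (z + of_real s * v) - f z) /\<^sub>R s - D = (f (z + of_real s * v) - f z - s *\<^sub>R D) /\<^sub>R s"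
      by (simp add: scaleR_diff_right)
    then show ?case by (simp add: divide_inverse mult.commute)
  qed
  ultimately have "((\<lambda>s. norm ((f (z + of_real s * v) - f z) /\<^sub>R s - D)) \<longlongrightarrow> 0) (at 0)"
    by (rule Lim_transform_eventually)
  then show ?thesis
    by (simp add: tendsto_norm_zero_iff LIM_zero_iff)
qed

text \<open>Both sides are limits of integrals of difference quotients, and a translation moves the quotient from
  the test function to \<open>f\<close>. The Lipschitz bound for \<open>f\<close> along \<open>v\<close> is required only at points of a compact
  set \<open>K\<close> off which the test function vanishes, so \<open>f\<close> may be badly behaved elsewhere.\<close>

lemma integration_by_parts_test_function:
  fixes f D :: "complex \<Rightarrow> complex"
  assumes \<phi>: "\<And>k. C_k k \<phi>" and v: "v = 1 \<or> v = \<i>"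
    and K: "compact K" "\<And>z. z \<notin> K \<Longrightarrow> \<phi> z = 0"
    and f: "continuous_on UNIV f" and D [measurable]: "D \<in> borel_measurable borel"
    and \<delta>: "0 < \<delta>"
    and lip: "\<And>z s. z \<in> K \<Longrightarrow> 0 < s \<Longrightarrow> s \<le> \<delta> \<Longrightarrow> norm (f (z - of_real s * v) - f z) \<le> C * s"
    and deriv: "AE z in lborel. z \<in> K \<longrightarrow>
      ((\<lambda>s. f (z + of_real s * v)) has_vector_derivative D z) (at 0)"
  shows "(LINT z|lborel. dir_deriv v \<phi> z *\<^sub>R f z) = - (LINT z|lborel. \<phi> z *\<^sub>R D z)"
proof -
  have v1: "norm v = 1" using v by auto
  define h where "h n = \<delta> / (real n + 1)" for n
  have h0: "0 < h n" "h n \<le> \<delta>" for n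
    using \<delta> mult_left_mono[of 1 "real n + 1" \<delta>] by (auto simp: h_def field_simps)
  have h_lim: "h \<longlonglongrightarrow> 0"
    unfolding h_def by real_asymp
  have \<phi>_cont: "continuous_on UNIV \<phi>"
    using \<phi> by (rule C_k_continuous)
  have D\<phi>_cont: "continuous_on UNIV (dir_deriv v \<phi>)"
    using \<phi>[of "Suc 0"] v by auto
  have [measurable]: "\<phi> \<in> borel_measurable borel" "f \<in> borel_measurable borel"
    "dir_deriv v \<phi> \<in> borel_measurable borel"
    using \<phi>_cont f D\<phi>_cont by (auto intro: borel_measurable_continuous_onI)
  note line = has_real_derivative_along_line[OF \<phi>[of "Suc 0"] v]
  have D\<phi>_0: "dir_deriv v \<phi> z = 0" if "z \<notin> K" for z
  proof -
    have "open (- K)" using K(1) by (simp add: compact_imp_closed open_Compl)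
    have "((\<lambda>z. 0) has_derivative (\<lambda>h. 0)) (at z)" by simp
    then have "(\<phi> has_derivative (\<lambda>h. 0)) (at z)"
      by (rule has_derivative_transform_within_open[OF _ \<open>open (- K)\<close>]) (use that K in auto)
    from frechet_derivative_at[OF this] show ?thesis
      by (metis dir_deriv_def)
  qed
  obtain B where B': "0 \<le> B" "\<And>z. z \<in> K \<Longrightarrow> norm (dir_deriv v \<phi> z) \<le> B"
    using compact_continuous_bound[OF K(1) continuous_on_subset[OF D\<phi>_cont]] by blast
  have B: "\<bar>dir_deriv v \<phi> z\<bar> \<le> B" "0 \<le> B" for z
    using B' D\<phi>_0[of z] by (cases "z \<in> K"; simp)+
  obtain M where M: "\<And>z. z \<in> K \<Longrightarrow> norm (\<phi> z) \<le> M"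
    using compact_continuous_bound[OF K(1) continuous_on_subset[OF \<phi>_cont]] by blast
  \<comment> \<open>contains the supports of all translates of \<open>\<phi>\<close> by at most \<open>\<delta>\<close> in direction \<open>- v\<close>\<close>
  define K' where "K' = (\<lambda>(z, s). z - of_real s * v) ` (K \<times> {0..\<delta>})"
  have K': "compact K'"
    unfolding K'_def case_prod_unfold
    using K(1) by (intro compact_continuous_image compact_Times compact_Icc continuous_intros)
  have in_K': "z \<in> K'" if "z + of_real s * v \<in> K" "0 \<le> s" "s \<le> \<delta>" for z s
    unfolding K'_def using that by (intro image_eqI[where x = "(z + of_real s * v, s)"]) auto
  define A where "A n = (LINT z|lborel. ((\<phi> (z + of_real (h n) * v) - \<phi> z) / h n) *\<^sub>R f z)" for n
  have A1: "A \<longlonglongrightarrow> (LINT z|lborel. dir_deriv v \<phi> z *\<^sub>R f z)"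
    unfolding A_def
  proof (rule integral_dominated_convergence[where w = "\<lambda>z. norm (indicator K' z *\<^sub>R (B *\<^sub>R f z))"])
    show "integrable lborel (\<lambda>z. norm (indicator K' z *\<^sub>R (B *\<^sub>R f z)))"
      using K' f by (intro integrable_norm borel_integrable_compact)
        (auto intro!: continuous_intros intro: continuous_on_subset)
    show "AE z in lborel. (\<lambda>n. ((\<phi> (z + of_real (h n) * v) - \<phi> z) / h n) *\<^sub>R f z) \<longlonglongrightarrow> dir_deriv v \<phi> z *\<^sub>R f z"
    proof (intro AE_I2 tendsto_scaleR tendsto_const)
      fix z
      have "((\<lambda>s. (\<phi> (z + of_real s * v) - \<phi> z) / s) \<longlongrightarrow> dir_deriv v \<phi> z) (at 0)"
        using line[of z 0] by (simp add: DERIV_def)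
      moreover have "filterlim h (at 0) sequentially"
        using h_lim h0(1) by (auto simp: filterlim_at less_imp_neq[symmetric])
      ultimately show "(\<lambda>n. (\<phi> (z + of_real (h n) * v) - \<phi> z) / h n) \<longlonglongrightarrow> dir_deriv v \<phi> z"
        by (rule filterlim_compose)
    qed
    show "AE z in lborel. norm (((\<phi> (z + of_real (h n) * v) - \<phi> z) / h n) *\<^sub>R f z)
        \<le> norm (indicator K' z *\<^sub>R (B *\<^sub>R f z))" for n
    proof (intro AE_I2)
      fix z
      have "\<bar>(\<phi> (z + of_real (h n) * v) - \<phi> z) / h n\<bar> \<le> indicator K' z * B"
      proof (cases "z \<in> K'")
        case True
        obtain \<xi> where "\<phi> (z + of_real (h n) * v) - \<phi> (z + of_real 0 * v) =
            (h n - 0) * dir_deriv v \<phi> (z + of_real \<xi> * v)"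
          using MVT2[OF h0(1) line] by blast
        with B h0(1)[of n] True show ?thesis by simp
      next
        case False
        then have "z \<notin> K" "z + of_real (h n) * v \<notin> K"
          using in_K'[of z 0] in_K'[of z "h n"] h0[of n] \<delta> by (auto simp: less_imp_le)
        with K False show ?thesis by simp
      qed
      then have "\<bar>(\<phi> (z + of_real (h n) * v) - \<phi> z) / h n\<bar> * norm (f z) \<le> indicator K' z * B * norm (f z)"
        by (rule mult_right_mono) simp
      then show "norm (((\<phi> (z + of_real (h n) * v) - \<phi> z) / h n) *\<^sub>R f z)
          \<le> norm (indicator K' z *\<^sub>R (B *\<^sub>R f z))"
        using B(2) by simp
    qed
  qed (measurable)
  have A_eq: "A n = (LINT z|lborel. \<phi> z *\<^sub>R ((f (z - of_real (h n) * v) - f z) /\<^sub>R h n))" for n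
  proof -
    define c where "c = of_real (h n) * v"
    have i1: "integrable lborel (\<lambda>z. \<phi> (c + z) *\<^sub>R f z)"
    proof (rule integrable_continuous_compact_support[OF _ K'])
      show "continuous_on UNIV (\<lambda>z. \<phi> (c + z) *\<^sub>R f z)"
        by (intro continuous_intros f continuous_on_compose2[OF \<phi>_cont]) auto
      fix z assume "z \<notin> K'"
      with in_K'[of z "h n"] h0[of n] have "c + z \<notin> K"
        by (auto simp: c_def add.commute less_imp_le)
      with K(2) show "\<phi> (c + z) *\<^sub>R f z = 0" by simp
    qed
    have i2: "integrable lborel (\<lambda>z. \<phi> z *\<^sub>R f z)"
      by (rule integrable_continuous_compact_support[OF _ K(1)])
        (use K(2) in \<open>auto intro!: continuous_intros f \<phi>_cont\<close>)
    have i3: "integrable lborel (\<lambda>z. \<phi> z *\<^sub>R f (z - c))"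
      by (rule integrable_continuous_compact_support[OF _ K(1)])
        (use K(2) in \<open>auto intro!: continuous_intros continuous_on_compose2[OF f] \<phi>_cont\<close>)
    have "A n = (LINT z|lborel. (\<phi> (c + z) *\<^sub>R f z - \<phi> z *\<^sub>R f z) /\<^sub>R h n)"
      unfolding A_def c_def
      by (simp add: scaleR_diff_left divide_inverse mult.commute add.commute flip: scaleR_scaleR)
    also have "\<dots> = ((LINT z|lborel. \<phi> (c + z) *\<^sub>R f z) - (LINT z|lborel. \<phi> z *\<^sub>R f z)) /\<^sub>R h n"
      using i1 i2 by simp
    also have "(LINT z|lborel. \<phi> (c + z) *\<^sub>R f z) = (LINT z|lborel. \<phi> z *\<^sub>R f (z - c))"
      using lborel_integral_translation[of "\<lambda>z. \<phi> z *\<^sub>R f (z - c)" c] by simp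
    also have "((LINT z|lborel. \<phi> z *\<^sub>R f (z - c)) - (LINT z|lborel. \<phi> z *\<^sub>R f z)) /\<^sub>R h n =
        (LINT z|lborel. (\<phi> z *\<^sub>R f (z - c) - \<phi> z *\<^sub>R f z) /\<^sub>R h n)"
      using i2 i3 by simp
    also have "\<dots> = (LINT z|lborel. \<phi> z *\<^sub>R ((f (z - c) - f z) /\<^sub>R h n))"
      by (simp add: scaleR_diff_right mult.commute)
    finally show ?thesis by (simp add: c_def)
  qed
  have A2: "A \<longlonglongrightarrow> (LINT z|lborel. \<phi> z *\<^sub>R (- D z))"
    unfolding A_eq
  proof (rule integral_dominated_convergence[where w = "\<lambda>z. indicator K z *\<^sub>R (M * C)"])
    show "integrable lborel (\<lambda>z. indicat_real K z *\<^sub>R (M * C))"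
      using K(1) by (intro borel_integrable_compact) auto
    show "AE z in lborel. (\<lambda>n. \<phi> z *\<^sub>R ((f (z - of_real (h n) * v) - f z) /\<^sub>R h n)) \<longlonglongrightarrow> \<phi> z *\<^sub>R (- D z)"
      using deriv
    proof eventually_elim
      case (elim z)
      show ?case
      proof (cases "z \<in> K")
        case True
        with elim have "((\<lambda>s. f (z + of_real s * v)) has_vector_derivative D z) (at 0)" by simp
        then have "((\<lambda>s. (f (z + of_real s * v) - f z) /\<^sub>R s) \<longlongrightarrow> D z) (at 0)"
          by (rule has_vector_derivative_quotient)
        moreover have "filterlim (\<lambda>n. - h n) (at 0) sequentially"
          using tendsto_minus[OF h_lim] h0(1) by (auto simp: filterlim_at less_imp_neq[symmetric])
        ultimately have "(\<lambda>n. (f (z + of_real (- h n) * v) - f z) /\<^sub>R (- h n)) \<longlonglongrightarrow> D z"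
          by (rule filterlim_compose)
        from tendsto_minus[OF this]
        have "(\<lambda>n. (f (z - of_real (h n) * v) - f z) /\<^sub>R h n) \<longlonglongrightarrow> - D z"
          by simp
        then show ?thesis by (intro tendsto_intros)
      next
        case False
        with K(2) show ?thesis by simp
      qed
    qed
    show "AE z in lborel. norm (\<phi> z *\<^sub>R ((f (z - of_real (h n) * v) - f z) /\<^sub>R h n))
        \<le> indicator K z *\<^sub>R (M * C)" for n
    proof (intro AE_I2)
      fix z
      show "norm (\<phi> z *\<^sub>R ((f (z - of_real (h n) * v) - f z) /\<^sub>R h n)) \<le> indicator K z *\<^sub>R (M * C)"
      proof (cases "z \<in> K")
        case True
        have "norm ((f (z - of_real (h n) * v) - f z) /\<^sub>R h n) \<le> C"
        proof -
          have "norm (f (z - of_real (h n) * v) - f z) / h n \<le> C"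
            using lip[OF True h0(1) h0(2), of n] h0(1)[of n] by (simp add: pos_divide_le_eq)
          then show ?thesis
            using h0(1)[of n] by (simp only: norm_scaleR) (simp add: divide_inverse_commute)
        qed
        with M[OF True] have "\<bar>\<phi> z\<bar> * norm ((f (z - of_real (h n) * v) - f z) /\<^sub>R h n) \<le> M * C"
          by (intro mult_mono) auto
        with True show ?thesis by (simp add: abs_mult mult.assoc)
      next
        case False
        with K(2) show ?thesis by simp
      qed
    qed
  qed (measurable)
  from LIMSEQ_unique[OF A1 A2] show ?thesis by simp
qed

section \<open>Weak derivatives of stretch functions\<close>

text \<open>A stretch function together with one Borel function \<open>g'\<close> that represents the derivative of the profile
  almost everywhere and satisfies the bound at every radius. Fixing such a representative makes all
  later integrands Borel functions of \<open>\<bar>z\<bar>\<close>. The equation for \<open>f\<close> covers \<open>z = 0\<close> too, where both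
  sides are \<open>0\<close>.\<close>

locale slow_stretch =
  fixes f :: "complex \<Rightarrow> complex" and g g' :: "real \<Rightarrow> real"
  assumes f_eq: "f z = (g (norm z) / norm z) *\<^sub>R z"
    and g_nonneg: "0 < r \<Longrightarrow> 0 \<le> g r"
    and g_lipschitz: "0 < a \<Longrightarrow> \<exists>L. L-lipschitz_on {a..b} g"
    and g_at_0: "(g \<longlongrightarrow> 0) (at_right 0)"
    and g_measurable [measurable]: "g \<in> borel_measurable borel"
    and g'_measurable [measurable]: "g' \<in> borel_measurable borel"
    and g'_le: "0 < r \<Longrightarrow> \<bar>g' r\<bar> \<le> g r / r"
    and g_deriv: "AE r in lborel. 0 < r \<longrightarrow> (g has_real_derivative g' r) (at r)"
begin

text \<open>The function \<open>q\<close> is the sum of the moduli of the two complex derivatives of \<open>f\<close>.\<close>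

definition q :: "real \<Rightarrow> real" where "q r = g r / r"

text \<open>This is the derivative of \<open>q\<close> in terms of \<open>g'\<close>.\<close>

definition q' :: "real \<Rightarrow> real" where "q' r = (g' r - q r) / r"

text \<open>The classical directional derivative of \<open>f z = q \<bar>z\<bar> z\<close>, by the product rule.\<close>

definition D :: "complex \<Rightarrow> complex \<Rightarrow> complex" where
  "D v z = q (norm z) *\<^sub>R v + (q' (norm z) * (inner z v / norm z)) *\<^sub>R z"

lemma q_measurable [measurable]: "q \<in> borel_measurable borel"
  and q'_measurable [measurable]: "q' \<in> borel_measurable borel"
  unfolding q_def q'_def by measurable

lemma D_measurable [measurable]: "D v \<in> borel_measurable borel"
  unfolding D_def by measurable

lemma q_nonneg: "0 < r \<Longrightarrow> 0 \<le> q r"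
  by (simp add: q_def g_nonneg)

lemma q_deriv: "(g has_real_derivative g' r) (at r) \<Longrightarrow> 0 < r \<Longrightarrow> (q has_real_derivative q' r) (at r)"
  unfolding q_def q'_def by (auto intro!: derivative_eq_intros simp: field_simps)

lemma q_lipschitz: "0 < a \<Longrightarrow> \<exists>L. L-lipschitz_on {a..b} q"
proof -
  assume a: "0 < a"
  obtain L where L: "L-lipschitz_on {a..b} g" using g_lipschitz[OF a] by blast
  have "\<exists>M. M-lipschitz_on {a..b} inverse"
    using a by (intro C1_lipschitz_on_Icc[where f' = "\<lambda>r. - (inverse r * inverse r)"])
      (auto intro!: derivative_eq_intros continuous_intros simp: power2_eq_square)
  then obtain M where M: "M-lipschitz_on {a..b} inverse" by blast
  show ?thesis
    using lipschitz_on_Icc_mult[OF L M] by (simp add: q_def[abs_def] divide_inverse)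
qed

lemma f_lipschitz:
  assumes a: "0 < a"
  shows "\<exists>C. C-lipschitz_on {z. a \<le> norm z \<and> norm z \<le> b} f"
proof -
  obtain L where L: "L-lipschitz_on {a..b} q" using q_lipschitz[OF a] by blast
  obtain B where B: "0 \<le> B" "\<And>r. r \<in> {a..b} \<Longrightarrow> norm (q r) \<le> B"
    using compact_continuous_bound[OF compact_Icc lipschitz_on_continuous_on[OF L]] by blast
  have "(L * \<bar>b\<bar> + B)-lipschitz_on {z. a \<le> norm z \<and> norm z \<le> b} f"
  proof (rule lipschitz_onI)
    fix z w :: complex assume zw: "z \<in> {z. a \<le> norm z \<and> norm z \<le> b}" "w \<in> {z. a \<le> norm z \<and> norm z \<le> b}"
    have "norm (f z - f w) = norm ((q (norm z) - q (norm w)) *\<^sub>R z + q (norm w) *\<^sub>R (z - w))"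
      by (simp add: f_eq q_def algebra_simps)
    also have "\<dots> \<le> \<bar>q (norm z) - q (norm w)\<bar> * norm z + \<bar>q (norm w)\<bar> * norm (z - w)"
      by (rule norm_triangle_le) simp
    also have "\<dots> \<le> (L * norm (z - w)) * \<bar>b\<bar> + B * norm (z - w)"
    proof (intro add_mono mult_mono)
      have "\<bar>q (norm z) - q (norm w)\<bar> \<le> L * \<bar>norm z - norm w\<bar>"
        using lipschitz_onD[OF L, of "norm z" "norm w"] zw by (simp add: dist_real_def)
      also have "\<dots> \<le> L * norm (z - w)"
        using lipschitz_on_nonneg[OF L] norm_triangle_ineq3 by (intro mult_left_mono) auto
      finally show "\<bar>q (norm z) - q (norm w)\<bar> \<le> L * norm (z - w)" .
      show "\<bar>q (norm w)\<bar> \<le> B" using B(2)[of "norm w"] zw by auto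
    qed (use zw lipschitz_on_nonneg[OF L] B(1) in auto)
    finally show "dist (f z) (f w) \<le> (L * \<bar>b\<bar> + B) * dist z w"
      by (simp add: dist_norm algebra_simps)
  qed (use lipschitz_on_nonneg[OF L] B(1) in simp)
  then show ?thesis by blast
qed

lemma f_continuous: "continuous_on UNIV f"
proof (intro continuous_at_imp_continuous_on ballI)
  fix z :: complex
  show "isCont f z"
  proof (cases "z = 0")
    case True
    have "filterlim norm (at_right 0) (at (0::complex))"
      by (auto simp: filterlim_at eventually_at_filter intro!: tendsto_eq_intros)
    then have "((\<lambda>z::complex. g (norm z)) \<longlongrightarrow> 0) (at 0)"
      using g_at_0 filterlim_compose by blast
    then have "(f \<longlongrightarrow> 0) (at 0)"
      by (rule Lim_null_comparison[rotated])
        (auto simp: eventually_at_filter f_eq g_nonneg)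
    with True show ?thesis by (simp add: isCont_def f_eq)
  next
    case False
    let ?A = "{w::complex. norm z / 2 < norm w \<and> norm w < 2 * norm z}"
    have A: "open ?A" "z \<in> ?A"
      using False by (auto intro!: open_Collect_conj open_Collect_less continuous_intros)
    obtain C where "C-lipschitz_on {w. norm z / 2 \<le> norm w \<and> norm w \<le> 2 * norm z} f"
      using f_lipschitz[of "norm z / 2"] False by auto
    then have "continuous_on ?A f"
      by (elim lipschitz_on_continuous_on[THEN continuous_on_subset]) auto
    with A show ?thesis by (simp add: continuous_on_eq_continuous_at)
  qed
qed

lemma f_deriv:
  "AE z in lborel. z \<noteq> 0 \<longrightarrow> ((\<lambda>s. f (z + of_real s * v)) has_vector_derivative D v z) (at 0)"
proof -
  have "AE z in lborel. (z::complex) \<noteq> 0 \<longrightarrow> (g has_real_derivative g' (norm z)) (at (norm z))"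
    using g_deriv by (rule AE_radial)
  then show ?thesis
  proof eventually_elim
    case (elim z)
    show ?case
    proof
      assume z: "z \<noteq> 0"
      have line: "((\<lambda>s. z + of_real s * v) has_vector_derivative v) (at 0)"
        by (auto intro!: derivative_eq_intros simp: has_vector_derivative_def scaleR_conv_of_real)
      have "(norm has_derivative (\<lambda>h. inner h (sgn z))) (at (z + of_real 0 * v))"
        using has_derivative_norm[OF z] by simp
      from has_derivative_compose[OF line[unfolded has_vector_derivative_def] this]
      have "((\<lambda>s. norm (z + of_real s * v)) has_real_derivative (inner z v / norm z)) (at 0)"
        unfolding has_field_derivative_def
        by (rule has_derivative_eq_rhs)
          (auto simp: fun_eq_iff sgn_div_norm inner_commute divide_inverse mult_ac)
      moreover have "(q has_real_derivative q' (norm z)) (at (norm (z + of_real 0 * v)))"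
        using elim z by (simp add: q_deriv)
      ultimately have "((\<lambda>s. q (norm (z + of_real s * v))) has_real_derivative
          q' (norm z) * (inner z v / norm z)) (at 0)"
        by (rule DERIV_chain2[rotated])
      from has_vector_derivative_scaleR[OF this line]
      show "((\<lambda>s. f (z + of_real s * v)) has_vector_derivative D v z) (at 0)"
        by (simp add: f_eq[abs_def] q_def[symmetric] D_def)
    qed
  qed
qed

lemma norm_D_le:
  assumes "z \<noteq> 0" "norm v = 1"
  shows "norm (D v z) \<le> 3 * q (norm z)"
proof -
  have r: "0 < norm z" using assms by simp
  have "norm (D v z) \<le> norm (q (norm z) *\<^sub>R v) + norm ((q' (norm z) * (inner z v / norm z)) *\<^sub>R z)"
    unfolding D_def by (rule norm_triangle_ineq)
  also have "\<dots> = q (norm z) + \<bar>q' (norm z)\<bar> * \<bar>inner z v\<bar>"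
    using r assms q_nonneg[OF r] by (simp add: abs_mult)
  also have "\<dots> \<le> q (norm z) + \<bar>q' (norm z)\<bar> * norm z"
    using Cauchy_Schwarz_ineq2[of z v] assms by (intro add_left_mono mult_left_mono) auto
  also have "\<bar>q' (norm z)\<bar> * norm z = \<bar>g' (norm z) - q (norm z)\<bar>"
    using r by (simp add: q'_def abs_divide)
  also have "\<dots> \<le> 2 * q (norm z)"
    using g'_le[OF r] by (simp add: q_def)
  finally show ?thesis by simp
qed

text \<open>A smooth function that is supported in the closed annulus \<open>1 / m \<le> \<bar>z\<bar>\<^sup>2 \<le> m\<close> and positive in its
  interior.\<close>

definition cutoff :: "nat \<Rightarrow> complex \<Rightarrow> real" where
  "cutoff m z = soft_step (real m * (norm z)\<^sup>2 - 1) * soft_step (real m - (norm z)\<^sup>2)"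

lemma C_k_cutoff: "C_k k (cutoff m)"
proof -
  have "C_k k (\<lambda>z. soft_step (real m * (Re z * Re z + Im z * Im z) - 1) *
      soft_step (real m - (Re z * Re z + Im z * Im z)))"
    by (intro C_k_mult C_k_add C_k_soft_step C_k_diff C_k_const C_k_bounded_linear
        bounded_linear_Re bounded_linear_Im)
  then show ?thesis
    by (simp add: cutoff_def[abs_def] cmod_power2 flip: power2_eq_square)
qed

text \<open>Near the origin neither a Lipschitz bound for \<open>f\<close> nor integrability of \<open>D v\<close> is available. Multiplication
  by a cutoff turns every smooth function into a test function on an annulus, where both hold, and at the same
  time makes the difference \<open>h - D v\<close> integrable. As every nonzero point is interior to some annulus,
  nothing is lost.\<close>

lemma weak_deriv_AE_eq:
  assumes v: "v = 1 \<or> v = \<i>" and h: "is_weak_deriv v f h"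
  shows "AE z in lebesgue. h z = D v z"
proof -
  have v1: "norm v = 1" using v by auto
  have ae: "AE z in lebesgue. cutoff m z *\<^sub>R (h z - D v z) = 0" if m: "m \<ge> 2" for m
  proof (rule AE_zero_if_orthogonal_to_smooth)
    \<comment> \<open>inner and outer radius of the annulus\<close>
    define a b where "a = sqrt (1 / real m)" and "b = sqrt (real m)"
    define K where "K = {z::complex. a \<le> norm z \<and> norm z \<le> b}"
    have a: "0 < a" using m by (simp add: a_def)
    have cut0: "cutoff m z = 0" if "z \<notin> K" for z
    proof (rule ccontr)
      assume "cutoff m z \<noteq> 0"
      then have "real m * (norm z)\<^sup>2 - 1 > 0" "real m - (norm z)\<^sup>2 > 0"
        unfolding cutoff_def by (metis mult_eq_0_iff not_le soft_step_nonpos)+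
      then have "1 / real m \<le> (norm z)\<^sup>2" "(norm z)\<^sup>2 \<le> real m"
        using m by (auto simp: field_simps)
      then have "z \<in> K"
        by (auto simp: K_def a_def b_def intro: real_le_lsqrt real_le_rsqrt)
      with that show False by simp
    qed
    have "closed K"
      unfolding K_def by (intro closed_Collect_conj closed_Collect_le continuous_intros)
    moreover have "K \<subseteq> cball 0 b" by (auto simp: K_def)
    ultimately have K: "compact K"
      by (meson bounded_cball bounded_subset compact_eq_bounded_closed)
    have cont: "continuous_on UNIV (cutoff m)" using C_k_cutoff by (rule C_k_continuous)
    then have cut_meas [measurable]: "cutoff m \<in> borel_measurable borel"
      by (rule borel_measurable_continuous_onI)
    have cut1: "\<bar>cutoff m z\<bar> \<le> 1" for z
      by (auto simp: cutoff_def abs_mult intro!: mult_le_one)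
    obtain B where B: "\<And>z. z \<in> K \<Longrightarrow> norm (D v z) \<le> B"
    proof -
      obtain L where "L-lipschitz_on {a..b} q" using q_lipschitz[OF a] by blast
      then obtain B where "0 \<le> B" "\<And>r. r \<in> {a..b} \<Longrightarrow> norm (q r) \<le> B"
        using compact_continuous_bound[OF compact_Icc lipschitz_on_continuous_on] by blast
      then have "norm (D v z) \<le> 3 * B" if "z \<in> K" for z
        using norm_D_le[of z v] v1 that a unfolding K_def by fastforce
      then show ?thesis using that by blast
    qed
    have int_h: "integrable lebesgue (\<lambda>z. \<phi> z *\<^sub>R cutoff m z *\<^sub>R h z)"
      and int_D: "integrable lborel (\<lambda>z. \<phi> z *\<^sub>R cutoff m z *\<^sub>R D v z)"
      if \<phi>: "continuous_on UNIV \<phi>" for \<phi>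
    proof -
      have [measurable]: "\<phi> \<in> borel_measurable borel"
        using \<phi> by (rule borel_measurable_continuous_onI)
      obtain M where M: "0 \<le> M" "\<And>z. z \<in> K \<Longrightarrow> norm (\<phi> z) \<le> M"
        using compact_continuous_bound[OF K continuous_on_subset[OF \<phi>]] by blast
      have bound: "norm (\<phi> z *\<^sub>R cutoff m z *\<^sub>R x) \<le> norm (indicat_real K z *\<^sub>R M *\<^sub>R y)"
        if "z \<in> K \<Longrightarrow> norm x \<le> norm y" for z and x y :: complex
      proof (cases "z \<in> K")
        case True
        have "\<bar>\<phi> z\<bar> * (\<bar>cutoff m z\<bar> * norm x) \<le> M * (1 * norm y)"
          using M(1) M(2)[OF True] cut1[of z] that[OF True] by (intro mult_mono) auto
        with True M(1) show ?thesis by (simp add: abs_mult mult.assoc)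
      next
        case False
        with cut0 show ?thesis by simp
      qed
      have hK: "integrable lebesgue (\<lambda>z. indicat_real K z *\<^sub>R h z)"
        using h K by (auto simp: is_weak_deriv_def locally_integrable_def set_integrable_def)
      have "(\<lambda>z. \<phi> z * cutoff m z) \<in> borel_measurable lebesgue"
        by (intro measurable_completion) measurable
      from borel_measurable_scaleR[OF this borel_measurable_integrable[OF hK]]
      have "(\<lambda>z. (\<phi> z * cutoff m z) *\<^sub>R (indicat_real K z *\<^sub>R h z)) \<in> borel_measurable lebesgue" .
      also have "(\<lambda>z. (\<phi> z * cutoff m z) *\<^sub>R (indicat_real K z *\<^sub>R h z)) = (\<lambda>z. \<phi> z *\<^sub>R cutoff m z *\<^sub>R h z)"
        using cut0 by (auto simp: indicator_def fun_eq_iff)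
      finally have meas: "(\<lambda>z. \<phi> z *\<^sub>R cutoff m z *\<^sub>R h z) \<in> borel_measurable lebesgue" .
      have hK': "integrable lebesgue (\<lambda>z. indicat_real K z *\<^sub>R M *\<^sub>R h z)"
        using integrable_scaleR_right[of M lebesgue "\<lambda>z. indicat_real K z *\<^sub>R h z"] hK
        by (simp add: mult.commute)
      show "integrable lebesgue (\<lambda>z. \<phi> z *\<^sub>R cutoff m z *\<^sub>R h z)"
        by (rule Bochner_Integration.integrable_bound[OF hK' meas]) (intro AE_I2 bound order_refl)
      have BK: "integrable lborel (\<lambda>z. indicat_real K z *\<^sub>R M *\<^sub>R complex_of_real B)"
        using K by (intro borel_integrable_compact) auto
      show "integrable lborel (\<lambda>z. \<phi> z *\<^sub>R cutoff m z *\<^sub>R D v z)"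
        by (rule Bochner_Integration.integrable_bound[OF BK]) (measurable, intro AE_I2 bound, use B in force)
    qed
    have int_D': "integrable lebesgue (\<lambda>z. \<phi> z *\<^sub>R cutoff m z *\<^sub>R D v z)"
      if \<phi>: "continuous_on UNIV \<phi>" for \<phi>
      using int_D[OF that] borel_measurable_integrable[OF int_D[OF that]]
      by (simp add: integrable_completion)
    show "integrable lebesgue (\<lambda>z. cutoff m z *\<^sub>R (h z - D v z))"
      using Bochner_Integration.integrable_diff[OF int_h int_D', of "\<lambda>_. 1" "\<lambda>_. 1"]
      by (simp add: scaleR_diff_right)
    fix \<phi> :: "complex \<Rightarrow> real" assume \<phi>: "\<And>j. C_k j \<phi>"
    have \<phi>_cont: "continuous_on UNIV \<phi>" using \<phi> by (rule C_k_continuous)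
    define \<psi> where "\<psi> z = \<phi> z * cutoff m z" for z
    have \<psi>: "C_k j \<psi>" for j
      unfolding \<psi>_def by (intro C_k_mult \<phi> C_k_cutoff)
    have \<psi>0: "\<psi> z = 0" if "z \<notin> K" for z
      using cut0[OF that] by (simp add: \<psi>_def)
    have "closure {z. \<psi> z \<noteq> 0} \<subseteq> K"
      using \<psi>0 by (intro closure_minimal \<open>closed K\<close>) auto
    then have "compact (closure {z. \<psi> z \<noteq> 0})"
      using K by (meson closed_closure compact_Int_closed compact_closure compact_imp_bounded bounded_subset closure_subset)
    with \<psi> have test: "test_function \<psi>"
      by (simp add: test_function_def)
    have [measurable]: "f \<in> borel_measurable borel" "\<psi> \<in> borel_measurable borel"
        "dir_deriv v \<psi> \<in> borel_measurable borel"
      using f_continuous C_k_continuous[OF \<psi>] \<psi>[of "Suc 0"] v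
      by (auto intro: borel_measurable_continuous_onI)
    have "(LINT z|lebesgue. \<psi> z *\<^sub>R h z) = - (LINT z|lebesgue. dir_deriv v \<psi> z *\<^sub>R f z)"
      using h test by (simp add: is_weak_deriv_def)
    also have "(LINT z|lebesgue. dir_deriv v \<psi> z *\<^sub>R f z) = (LINT z|lborel. dir_deriv v \<psi> z *\<^sub>R f z)"
      by (rule integral_completion) measurable
    also have "\<dots> = - (LINT z|lborel. \<psi> z *\<^sub>R D v z)"
    proof -
      obtain C where C: "C-lipschitz_on {z. a / 2 \<le> norm z \<and> norm z \<le> b + a} f"
        using f_lipschitz[of "a / 2"] a by auto
      show ?thesis
      proof (rule integration_by_parts_test_function[OF \<psi> v K \<psi>0 f_continuous D_measurable, where \<delta> = "a / 2"])
        show "0 < a / 2" using a by simp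
        fix z s assume zs: "z \<in> K" "0 < s" "s \<le> a / 2"
        have "norm (of_real s * v) = s" using v1 zs by (simp add: norm_mult)
        moreover from this have "norm z - s \<le> norm (z - of_real s * v)" "norm (z - of_real s * v) \<le> norm z + s"
          using norm_triangle_ineq2[of z "of_real s * v"] norm_triangle_ineq4[of z "of_real s * v"] by auto
        ultimately show "norm (f (z - of_real s * v) - f z) \<le> C * s"
          using lipschitz_onD[OF C, of "z - of_real s * v" z] zs a
          by (auto simp: K_def dist_norm)
      next
        show "AE z in lborel. z \<in> K \<longrightarrow> ((\<lambda>s. f (z + of_real s * v)) has_vector_derivative D v z) (at 0)"
          using f_deriv[of v] by eventually_elim (use a in \<open>auto simp: K_def\<close>)
      qed auto
    qed
    also have "(LINT z|lborel. \<psi> z *\<^sub>R D v z) = (LINT z|lebesgue. \<psi> z *\<^sub>R D v z)"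
      by (rule integral_completion[symmetric]) measurable
    finally have "(LINT z|lebesgue. \<psi> z *\<^sub>R h z) - (LINT z|lebesgue. \<psi> z *\<^sub>R D v z) = 0" by simp
    then show "(LINT z|lebesgue. \<phi> z *\<^sub>R cutoff m z *\<^sub>R (h z - D v z)) = 0"
      using int_h[OF \<phi>_cont] int_D'[OF \<phi>_cont]
      by (simp add: \<psi>_def scaleR_diff_right)
  qed
  have "AE z in lebesgue. \<forall>m. cutoff (m + 2) z *\<^sub>R (h z - D v z) = 0"
    unfolding AE_all_countable by (intro allI ae) simp
  moreover have "AE z in lebesgue. z \<noteq> (0::complex)"
    by (intro AE_completion AE_lborel_singleton)
  ultimately show ?thesis
  proof eventually_elim
    case (elim z)
    obtain m where m: "real m > 1 / (norm z)\<^sup>2 + (norm z)\<^sup>2"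
      using reals_Archimedean2 by blast
    have z: "0 < (norm z)\<^sup>2" using elim by simp
    then have "0 \<le> 1 / (norm z)\<^sup>2" by simp
    with m z have "1 / (norm z)\<^sup>2 < real (m + 2)" "(norm z)\<^sup>2 < real (m + 2)"
      unfolding of_nat_add by linarith+
    then have "cutoff (m + 2) z > 0"
      using z unfolding cutoff_def by (intro mult_pos_pos soft_step_pos) (auto simp: field_simps)
    with elim show ?case
      by (metis diff_eq_diff_eq eq_iff_diff_eq_0 less_irrefl scaleR_eq_0_iff)
  qed
qed

text \<open>Before the division by \<open>2\<close>, the radial part \<open>q' (z \<bullet> v) z / \<bar>z\<bar>\<close> of the two
  directional derivatives combines to \<open>q' z z\<^sup>* / \<bar>z\<bar> = q' \<bar>z\<bar>\<close> here
  and to \<open>q' z\<^sup>2 / \<bar>z\<bar>\<close> in the conjugate derivative, while the part \<open>q v\<close> contributes \<open>2 q\<close> here and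
  cancels there.\<close>

lemma d_z_formula: "z \<noteq> 0 \<Longrightarrow> (D 1 z - \<i> * D \<i> z) / 2 = of_real ((q (norm z) + g' (norm z)) / 2)"
proof -
  assume z: "z \<noteq> 0"
  let ?r = "norm z"
  have "D 1 z - \<i> * D \<i> z = of_real (2 * q ?r) + of_real (q' ?r / ?r) * (z * cnj z)"
    by (simp add: D_def complex_eq_iff scaleR_conv_of_real inner_complex_def algebra_simps diff_divide_distrib add_divide_distrib)
  also have "z * cnj z = of_real (?r * ?r)"
    by (simp add: complex_norm_square power2_eq_square flip: complex_norm_square)
  also have "of_real (2 * q ?r) + of_real (q' ?r / ?r) * complex_of_real (?r * ?r) =
      of_real (2 * q ?r + q' ?r * ?r)"
    using z by (simp only: of_real_mult[symmetric] of_real_add[symmetric]) simp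
  also have "2 * q ?r + q' ?r * ?r = q ?r + g' ?r"
    using z by (simp add: q'_def)
  finally show ?thesis by simp
qed

lemma norm_d_zbar_formula:
  "z \<noteq> 0 \<Longrightarrow> norm ((D 1 z + \<i> * D \<i> z) / 2) = (q (norm z) - g' (norm z)) / 2"
proof -
  assume z: "z \<noteq> 0"
  let ?r = "norm z"
  have "D 1 z + \<i> * D \<i> z = of_real (q' ?r / ?r) * (z * z)"
    by (simp add: D_def complex_eq_iff scaleR_conv_of_real inner_complex_def algebra_simps diff_divide_distrib add_divide_distrib)
  then have "norm (D 1 z + \<i> * D \<i> z) = \<bar>q' ?r\<bar> * ?r"
    using z by (simp add: norm_mult norm_divide)
  also have "\<dots> = \<bar>g' ?r - q ?r\<bar>"
    using z by (simp add: q'_def)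
  also have "\<dots> = q ?r - g' ?r"
    using z g'_le[of ?r] by (simp add: q_def)
  finally show ?thesis by (simp add: norm_divide)
qed

lemma weak_deriv_exists_AE_eq:
  assumes "f \<in> hom_sobolev p" "v = 1 \<or> v = \<i>"
  shows "AE z in lebesgue. weak_deriv v f z = D v z"
proof -
  have "\<exists>h. is_weak_deriv v f h"
    using assms by (auto simp: hom_sobolev_def)
  then have "is_weak_deriv v f (weak_deriv v f)"
    unfolding weak_deriv_def by (rule someI_ex)
  with assms(2) show ?thesis by (rule weak_deriv_AE_eq)
qed

lemma AE_norm_d:
  assumes "f \<in> hom_sobolev p"
  shows "AE z in lebesgue. z \<noteq> 0 \<and> norm (d_z f z) = (q (norm z) + g' (norm z)) / 2 \<and>
    norm (d_zbar f z) = (q (norm z) - g' (norm z)) / 2"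
proof -
  have "AE z in lebesgue. z \<noteq> (0::complex)"
    by (intro AE_completion AE_lborel_singleton)
  with weak_deriv_exists_AE_eq[OF assms, of 1, simplified] weak_deriv_exists_AE_eq[OF assms, of \<i>, simplified]
  show ?thesis
  proof eventually_elim
    case (elim z)
    have "d_z f z = of_real ((q (norm z) + g' (norm z)) / 2)"
      using elim d_z_formula[of z] by (simp add: d_z_def)
    moreover have "0 \<le> q (norm z) + g' (norm z)"
      using g'_le[of "norm z"] elim by (simp add: q_def)
    ultimately have "norm (d_z f z) = (q (norm z) + g' (norm z)) / 2"
      by (simp only: norm_of_real) simp
    moreover have "norm (d_zbar f z) = (q (norm z) - g' (norm z)) / 2"
      using elim norm_d_zbar_formula[of z] by (simp add: d_zbar_def)
    ultimately show ?case using elim by simp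
  qed
qed

lemma q_le_norm_D:
  assumes "z \<noteq> 0"
  shows "q (norm z) \<le> norm (D 1 z) + norm (D \<i> z)"
proof -
  have "q (norm z) \<le> norm ((D 1 z - \<i> * D \<i> z) / 2) + norm ((D 1 z + \<i> * D \<i> z) / 2)"
    unfolding d_z_formula[OF assms] norm_d_zbar_formula[OF assms] norm_of_real
    using abs_ge_self[of "q (norm z) + g' (norm z)"] by (simp add: field_simps)
  also have "norm ((D 1 z - \<i> * D \<i> z) / 2) \<le> (norm (D 1 z) + norm (D \<i> z)) / 2"
    using norm_triangle_ineq4[of "D 1 z" "\<i> * D \<i> z"] by (simp add: norm_divide norm_mult)
  also have "norm ((D 1 z + \<i> * D \<i> z) / 2) \<le> (norm (D 1 z) + norm (D \<i> z)) / 2"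
    using norm_triangle_ineq[of "D 1 z" "\<i> * D \<i> z"] by (simp add: norm_divide norm_mult)
  finally show ?thesis by simp
qed

text \<open>The function \<open>q\<close> is dominated by the sum of the moduli of the two partial derivatives, and the weak
  derivatives in \<open>L\<^sup>p\<close> that membership in \<open>hom_sobolev p\<close> provides agree with those almost everywhere.\<close>

lemma integrable_q_powr:
  assumes f: "f \<in> hom_sobolev p" and p: "0 < p"
  shows "integrable lborel (\<lambda>z::complex. q (norm z) powr p)"
proof -
  obtain h k where h: "is_weak_deriv 1 f h" "in_Lp p h" and k: "is_weak_deriv \<i> f k" "in_Lp p k"
    using f by (auto simp: hom_sobolev_def)
  have "integrable lebesgue (\<lambda>z. 2 powr p * (norm (h z) powr p + norm (k z) powr p))"
    using h k by (auto simp: in_Lp_def)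
  moreover have "(\<lambda>z::complex. q (norm z) powr p) \<in> borel_measurable lebesgue"
    by (intro measurable_completion) measurable
  moreover have "AE z in lebesgue. norm (q (norm z) powr p) \<le>
      norm (2 powr p * (norm (h z) powr p + norm (k z) powr p))"
  proof -
    have "AE z in lebesgue. z \<noteq> (0::complex)"
      by (intro AE_completion AE_lborel_singleton)
    with weak_deriv_AE_eq[OF disjI1[OF refl] h(1)] weak_deriv_AE_eq[OF disjI2[OF refl] k(1)]
    show ?thesis
    proof eventually_elim
      case (elim z)
      define m where "m = max (norm (h z)) (norm (k z))"
      have "q (norm z) \<le> 2 * m"
        using q_le_norm_D[of z] elim by (simp add: m_def)
      then have "q (norm z) powr p \<le> (2 * m) powr p"
        using q_nonneg[of "norm z"] elim p by (intro powr_mono2) auto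
      also have "\<dots> = 2 powr p * m powr p"
        by (rule powr_mult)
      also have "\<dots> \<le> 2 powr p * (norm (h z) powr p + norm (k z) powr p)"
        by (intro mult_left_mono) (auto simp: m_def max_def)
      finally show ?case by simp
    qed
  qed
  ultimately have "integrable lebesgue (\<lambda>z::complex. q (norm z) powr p)"
    by (rule Bochner_Integration.integrable_bound)
  then show ?thesis
    by (subst (asm) integrable_completion) measurable
qed

section \<open>Radial potentials\<close>

text \<open>The radial integrand is \<open>G\<close>, and \<open>2 r G r\<close> is the derivative of \<open>F r = r\<^sup>2 \<psi> (q r)\<close>. The growth bounds on
  \<open>\<psi>\<close> and \<open>\<psi>'\<close> dominate \<open>G\<close> and \<open>F r / r\<^sup>2\<close> by multiples of \<open>q\<^sup>p\<close>, which is integrable over the plane.\<close>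

lemma integral_radial_potential_eq_0:
  assumes f: "f \<in> hom_sobolev p" and p: "0 < p"
    and \<psi>: "\<And>t. (\<psi> has_real_derivative \<psi>' t) (at t)" and \<psi>'_cont: "continuous_on UNIV \<psi>'"
    and \<psi>_le: "\<And>t. 0 \<le> t \<Longrightarrow> \<bar>\<psi> t\<bar> \<le> C * t powr p"
    and \<psi>'_le: "\<And>t. 0 \<le> t \<Longrightarrow> \<bar>\<psi>' t\<bar> \<le> C * t powr (p - 1)"
  shows "has_bochner_integral lebesgue (\<lambda>z. \<psi> (norm (d_z f z) + norm (d_zbar f z)) -
    norm (d_zbar f z) * \<psi>' (norm (d_z f z) + norm (d_zbar f z))) 0"
proof -
  have \<psi>_cont: "continuous_on UNIV \<psi>"
    using \<psi> by (meson DERIV_continuous continuous_at_imp_continuous_on)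
  have [measurable]: "\<psi> \<in> borel_measurable borel" "\<psi>' \<in> borel_measurable borel"
    using \<psi>_cont \<psi>'_cont by (auto intro: borel_measurable_continuous_onI)
  define G where "G r = \<psi> (q r) - (q r - g' r) / 2 * \<psi>' (q r)" for r
  define F where "F r = r * r * \<psi> (q r)" for r
  have G_meas [measurable]: "G \<in> borel_measurable borel"
    unfolding G_def by measurable
  have pot: "\<bar>\<psi> (q r)\<bar> \<le> C * q r powr p" if "0 < r" for r
    using \<psi>_le q_nonneg[OF that] .
  have G_le: "\<bar>G r\<bar> \<le> 2 * C * q r powr p" if "0 < r" for r
  proof -
    have q0: "0 \<le> q r" using q_nonneg[OF that] .
    have "\<bar>g' r\<bar> \<le> q r" using g'_le[OF that] by (simp add: q_def)
    then have "\<bar>(q r - g' r) / 2\<bar> \<le> q r"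
      unfolding abs_le_iff by (intro conjI; simp add: field_simps; linarith)
    then have "\<bar>(q r - g' r) / 2\<bar> * \<bar>\<psi>' (q r)\<bar> \<le> q r * (C * q r powr (p - 1))"
      using \<psi>'_le[OF q0] q0 by (intro mult_mono) auto
    also have "\<dots> = C * q r powr p"
      using q0 powr_mult_base[of "q r" "p - 1"] by (simp add: mult.left_commute)
    finally show ?thesis
      using pot[OF that] abs_triangle_ineq4[of "\<psi> (q r)" "(q r - g' r) / 2 * \<psi>' (q r)"]
      unfolding G_def by (simp only: abs_mult)
  qed
  have powr_int: "set_integrable lborel {0<..} (\<lambda>r. r * q r powr p)"
    using integrable_q_powr[OF f] p by (subst integrable_radial_iff[symmetric]) auto
  have int_G: "set_integrable lborel {0<..} (\<lambda>r. r * G r)"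
  proof (rule set_integrable_bound)
    show "set_integrable lborel {0<..} (\<lambda>r. 2 * C * (r * q r powr p))"
      using powr_int by (rule set_integrable_mult_right)
    show "set_borel_measurable lborel {0<..} (\<lambda>r. r * G r)"
      unfolding set_borel_measurable_def by measurable
    show "AE r in lborel. r \<in> {0<..} \<longrightarrow> norm (r * G r) \<le> norm (2 * C * (r * q r powr p))"
    proof (intro AE_I2 impI)
      fix r :: real assume "r \<in> {0<..}"
      then have r: "0 < r" by simp
      have "norm (r * G r) = r * \<bar>G r\<bar>" using r by (simp add: abs_mult)
      also have "\<dots> \<le> r * (2 * C * q r powr p)" using G_le[OF r] r by (intro mult_left_mono) auto
      also have "\<dots> = 2 * C * (r * q r powr p)" by simp
      also have "\<dots> \<le> norm \<dots>" by simp
      finally show "norm (r * G r) \<le> norm (2 * C * (r * q r powr p))" .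
    qed
  qed
  have "(LINT r:{0<..}|lborel. 2 * (r * G r)) = 0"
  proof (rule integral_derivative_half_line_eq_0[where F = F])
    show "(\<lambda>r. 2 * (r * G r)) \<in> borel_measurable borel" by measurable
    show "set_integrable lborel {0<..} (\<lambda>r. 2 * (r * G r))"
      using int_G by (rule set_integrable_mult_right)
    show "AE r in lborel. 0 < r \<longrightarrow> (F has_real_derivative 2 * (r * G r)) (at r)"
      using g_deriv
    proof eventually_elim
      case (elim r)
      show ?case
      proof
        assume r: "0 < r"
        have sq: "((\<lambda>r. r * r) has_real_derivative 2 * r) (at r)"
          by (auto intro!: derivative_eq_intros)
        from r have "(q has_real_derivative q' r) (at r)" using elim q_deriv by blast
        note DERIV_chain2[OF \<psi> this]
        from DERIV_mult[OF sq this]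
        have "(F has_real_derivative 2 * r * \<psi> (q r) + \<psi>' (q r) * q' r * (r * r)) (at r)"
          by (simp only: F_def[abs_def])
        moreover have "\<psi>' (q r) * q' r * (r * r) = \<psi>' (q r) * (r * (g' r - q r))"
          using r by (simp add: q'_def)
        then have "2 * r * \<psi> (q r) + \<psi>' (q r) * q' r * (r * r) = 2 * (r * G r)"
          by (simp only: G_def) (simp add: field_simps)
        ultimately show "(F has_real_derivative 2 * (r * G r)) (at r)" by simp
      qed
    qed
    show "\<exists>L. L-lipschitz_on {a..b} F" if a: "0 < a" for a b
    proof -
      obtain L where L: "L-lipschitz_on {a..b} q" using q_lipschitz[OF a] by blast
      obtain B where B: "\<And>r. r \<in> {a..b} \<Longrightarrow> norm (q r) \<le> B"
        using compact_continuous_bound[OF compact_Icc lipschitz_on_continuous_on[OF L]] by blast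
      obtain M where "M-lipschitz_on {-B..B} \<psi>"
        using C1_lipschitz_on_Icc[OF \<psi> continuous_on_subset[OF \<psi>'_cont]] by blast
      then have "M-lipschitz_on (q ` {a..b}) \<psi>"
        by (rule lipschitz_on_subset) (use B in \<open>force simp: abs_le_iff\<close>)
      from lipschitz_on_compose2[OF L this]
      have "(M * L)-lipschitz_on {a..b} (\<lambda>r. \<psi> (q r))" .
      moreover obtain N where "N-lipschitz_on {a..b} (\<lambda>r. r * r)"
        using lipschitz_on_Icc_mult[OF lipschitz_on_id lipschitz_on_id] by blast
      ultimately show ?thesis
        unfolding F_def[abs_def] using lipschitz_on_Icc_mult by blast
    qed
    show "set_integrable lborel {0<..} (\<lambda>r. F r / r)"
    proof (rule set_integrable_bound)
      show "set_integrable lborel {0<..} (\<lambda>r. C * (r * q r powr p))"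
        using powr_int by (rule set_integrable_mult_right)
      show "set_borel_measurable lborel {0<..} (\<lambda>r. F r / r)"
        unfolding set_borel_measurable_def F_def by measurable
      show "AE r in lborel. r \<in> {0<..} \<longrightarrow> norm (F r / r) \<le> norm (C * (r * q r powr p))"
      proof (intro AE_I2 impI)
        fix r :: real assume "r \<in> {0<..}"
        then have r: "0 < r" by simp
        have "norm (F r / r) = r * \<bar>\<psi> (q r)\<bar>" using r by (simp add: F_def abs_mult)
        also have "\<dots> \<le> r * (C * q r powr p)" using pot[OF r] r by (intro mult_left_mono) auto
        also have "\<dots> = C * (r * q r powr p)" by simp
        also have "\<dots> \<le> norm \<dots>" by simp
        finally show "norm (F r / r) \<le> norm (C * (r * q r powr p))" .
      qed
    qed
  qed
  then have "(LINT r:{0<..}|lborel. r * G r) = 0" by simp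
  then have "has_bochner_integral lborel (\<lambda>z::complex. G (norm z)) 0"
    using int_G by (simp add: has_bochner_integral_iff integrable_radial_iff integral_radial)
  then have has: "has_bochner_integral lebesgue (\<lambda>z::complex. G (norm z)) 0"
    by (simp add: has_bochner_integral_iff integrable_completion integral_completion)
  have ae: "AE z in lebesgue. G (norm z) = \<psi> (norm (d_z f z) + norm (d_zbar f z)) -
    norm (d_zbar f z) * \<psi>' (norm (d_z f z) + norm (d_zbar f z))"
    using AE_norm_d[OF f]
  proof eventually_elim
    case (elim z)
    then have "norm (d_z f z) + norm (d_zbar f z) = q (norm z)" by (simp add: field_simps)
    moreover have "norm (d_zbar f z) = (q (norm z) - g' (norm z)) / 2" using elim by blast
    ultimately show ?case by (simp only: G_def)
  qed
  have meas: "(\<lambda>z::complex. G (norm z)) \<in> borel_measurable lebesgue"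
    by (intro measurable_completion) measurable
  show ?thesis
    by (rule has_bochner_integralI_AE[OF has borel_measurable_AE[OF meas ae] ae])
qed

end

text \<open>The profile is arbitrary on the negative half-line; setting it to \<open>0\<close> there makes it Borel
  measurable. A Borel representative of its derivative is the limit of difference quotients, set to \<open>0\<close>
  wherever it violates the bound, which happens only on a null set.\<close>

lemma stretch_functions1_imp_slow_stretch:
  assumes "f \<in> stretch_functions1"
  shows "\<exists>g g'. slow_stretch f g g'"
proof -
  obtain g where g: "is_stretch_of f g" and ae: "AE r in lebesgue. 0 < r \<longrightarrow>
      (\<exists>c. (g has_real_derivative c) (at r) \<and> \<bar>c\<bar> \<le> g r / r)"
    using assms by (auto simp: stretch_functions1_def)
  then have prof: "stretch_profile g" by (simp add: is_stretch_of_def)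
  have lip: "\<exists>L. L-lipschitz_on {a..b} g" if "0 < a" for a b
  proof -
    have "local_lipschitz {0::real} {a..b} (\<lambda>_. g)"
      using prof that by (auto simp: stretch_profile_def elim!: local_lipschitz_subset)
    then obtain L where "L-lipschitz_on {a..b} g"
      by (rule local_lipschitz_compact_implies_lipschitz[where T = "{0::real}" and f = "\<lambda>_. g"]) auto
    then show ?thesis by blast
  qed
  define g0 where "g0 r = (if 0 < r then g r else 0)" for r
  define slope where "slope r = lim (\<lambda>n. (g0 (r + 1 / (real n + 1)) - g0 r) / (1 / (real n + 1)))" for r
  define g' where "g' r = (if 0 < r \<and> \<bar>slope r\<bar> \<le> g0 r / r then slope r else 0)" for r
  have "continuous_on {0<..} g"
  proof (rule continuous_at_imp_continuous_on, rule ballI)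
    fix r :: real assume "r \<in> {0<..}"
    then have r: "0 < r" by simp
    obtain L where "L-lipschitz_on {r / 2..2 * r} g" using lip[of "r / 2"] r by auto
    then have "continuous_on {r / 2<..<2 * r} g"
      by (elim lipschitz_on_continuous_on[THEN continuous_on_subset]) auto
    with r show "isCont g r" by (simp add: continuous_on_eq_continuous_at)
  qed
  then have "(\<lambda>r. indicator {0<..} r *\<^sub>R g r) \<in> borel_measurable borel"
    by (intro borel_measurable_continuous_on_indicator) auto
  also have "(\<lambda>r. indicator {0<..} r *\<^sub>R g r) = g0"
    by (auto simp: g0_def fun_eq_iff)
  finally have g0_meas [measurable]: "g0 \<in> borel_measurable borel" .
  have slope_meas [measurable]: "slope \<in> borel_measurable borel"
    unfolding slope_def by measurable
  have deriv0: "(g0 has_real_derivative c) (at r)" if "(g has_real_derivative c) (at r)" "0 < r" for c r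
    using that by (elim has_field_derivative_transform_within_open[where S = "{0<..}"]) (auto simp: g0_def)
  have slope: "slope r = c" if "(g0 has_real_derivative c) (at r)" for c r
  proof -
    have "filterlim (\<lambda>n. 1 / (real n + 1)) (at 0) sequentially"
      by (auto simp: filterlim_at intro!: always_eventually) real_asymp
    moreover have "((\<lambda>h. (g0 (r + h) - g0 r) / h) \<longlongrightarrow> c) (at 0)"
      using that by (simp add: DERIV_def)
    ultimately show ?thesis
      unfolding slope_def by (intro limI) (rule filterlim_compose[rotated])
  qed
  have "slow_stretch f g0 g'"
  proof
    show "f z = (g0 (norm z) / norm z) *\<^sub>R z" for z
    proof -
      have "f (of_real (norm z) * cis (Arg z)) = of_real (g (norm z)) * cis (Arg z)"
        using g by (simp add: is_stretch_of_def)
      moreover have "of_real (norm z) * cis (Arg z) = z"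
        using rcis_cmod_Arg[of z] by (simp add: rcis_def)
      moreover have "g 0 = 0" using prof by (simp add: stretch_profile_def)
      ultimately show ?thesis
        by (cases "z = 0") (simp_all add: g0_def cis_Arg sgn_div_norm scaleR_conv_of_real field_simps)
    qed
    show "\<exists>L. L-lipschitz_on {a..b} g0" if "0 < a" for a b
    proof -
      obtain L where "L-lipschitz_on {a..b} g" using lip \<open>0 < a\<close> by blast
      then have "L-lipschitz_on {a..b} g0"
        by (rule lipschitz_on_transform) (use \<open>0 < a\<close> in \<open>simp add: g0_def\<close>)
      then show ?thesis by blast
    qed
    show "(g0 \<longlongrightarrow> 0) (at_right 0)"
      using prof by (auto simp: stretch_profile_def g0_def eventually_at_right_less
          elim!: Lim_transform_eventually intro: eventually_mono[OF eventually_at_right_less])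
    show "0 \<le> g0 r" if "0 < r" for r
      using prof that by (simp add: g0_def stretch_profile_def)
    then show "\<bar>g' r\<bar> \<le> g0 r / r" if "0 < r" for r
      using that by (simp add: g'_def)
    show "AE r in lborel. 0 < r \<longrightarrow> (g0 has_real_derivative g' r) (at r)"
      using ae[unfolded AE_completion_iff]
    proof eventually_elim
      case (elim r)
      show ?case
      proof
        assume r: "0 < r"
        with elim obtain c where c: "(g has_real_derivative c) (at r)" "\<bar>c\<bar> \<le> g r / r" by blast
        have "g' r = c"
          using slope[OF deriv0[OF c(1) r]] c(2) r by (simp add: g'_def g0_def)
        with deriv0[OF c(1) r] show "(g0 has_real_derivative g' r) (at r)" by simp
      qed
    qed
    show "g' \<in> borel_measurable borel" unfolding g'_def by measurable
  qed (rule g0_meas)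
  then show ?thesis by blast
qed

section \<open>Vanishing of the integrals\<close>

lemma has_real_derivative_max_0_powr:
  fixes p t :: real
  assumes p: "1 < p"
  shows "((\<lambda>t. max 0 t powr p) has_real_derivative p * max 0 t powr (p - 1)) (at t)"
proof -
  consider "t < 0" | "t > 0" | "t = 0" by linarith
  then show ?thesis
  proof cases
    case 1
    have "((\<lambda>_. 0) has_real_derivative 0) (at t)" by simp
    then have "((\<lambda>t. max 0 t powr p) has_real_derivative 0) (at t)"
      by (rule has_field_derivative_transform_within_open[of _ _ _ "{..<0}"]) (use 1 in auto)
    with 1 show ?thesis by simp
  next
    case 2
    have "((\<lambda>t. t powr p) has_real_derivative p * t powr (p - 1)) (at t)"
      using 2 by (rule has_real_derivative_powr)
    then have "((\<lambda>t. max 0 t powr p) has_real_derivative p * t powr (p - 1)) (at t)"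
      by (rule has_field_derivative_transform_within_open[of _ _ _ "{0<..}"]) (use 2 in auto)
    with 2 show ?thesis by simp
  next
    case 3
    have "((\<lambda>h::real. \<bar>h\<bar> powr (p - 1)) \<longlongrightarrow> \<bar>0\<bar> powr (p - 1)) (at 0)"
      by (rule tendsto_powr') (use p in \<open>auto intro!: tendsto_eq_intros\<close>)
    then have lim: "((\<lambda>h::real. \<bar>h\<bar> powr (p - 1)) \<longlongrightarrow> 0) (at 0)" by simp
    have le: "norm (max 0 h powr p / h) \<le> \<bar>h\<bar> powr (p - 1)" for h :: real
    proof (cases "0 < h")
      case True
      then show ?thesis by (simp add: powr_diff)
    next
      case False
      then have "max 0 h = 0" by simp
      then show ?thesis by simp
    qed
    have "((\<lambda>h. max 0 h powr p / h) \<longlongrightarrow> 0) (at 0)"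
      by (rule Lim_null_comparison[where f = "\<lambda>h. max 0 h powr p / h",
            OF always_eventually[OF allI[OF le]] lim])
    then have "((\<lambda>t. max 0 t powr p) has_real_derivative 0) (at 0)"
      unfolding DERIV_def by (rule Lim_transform_eventually) simp
    with 3 p show ?thesis by simp
  qed
qed

lemma continuous_on_max_0_powr:
  fixes p :: real
  assumes "0 < p"
  shows "continuous_on UNIV (\<lambda>t::real. max 0 t powr p)"
  by (rule continuous_on_powr') (use assms in \<open>auto intro!: continuous_on_max continuous_on_const continuous_on_id\<close>)

text \<open>For \<open>t \<le> 1\<close> the potential is \<open>t\<^sup>2\<close> and for \<open>t \<ge> 1\<close> it is \<open>2 t - 1\<close>. It is written with a maximum
  because its differentiability at \<open>1\<close> then follows from that of \<open>(max 0 t)\<^sup>2\<close>.\<close>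

lemma integral_L_fun_eq_0:
  assumes "f \<in> stretch_functions1 \<inter> hom_sobolev 2"
  shows "has_bochner_integral lebesgue (\<lambda>z. L_fun (d_z f z) (d_zbar f z)) 0"
proof -
  obtain g g' where "slow_stretch f g g'"
    using assms stretch_functions1_imp_slow_stretch by blast
  then interpret slow_stretch f g g' .
  define \<psi> :: "real \<Rightarrow> real" where "\<psi> t = t\<^sup>2 - max 0 (t - 1) powr 2" for t
  define \<psi>' :: "real \<Rightarrow> real" where "\<psi>' t = 2 * t - 2 * max 0 (t - 1)" for t
  have "has_bochner_integral lebesgue (\<lambda>z. \<psi> (norm (d_z f z) + norm (d_zbar f z)) -
    norm (d_zbar f z) * \<psi>' (norm (d_z f z) + norm (d_zbar f z))) 0"
  proof (rule integral_radial_potential_eq_0[where p = 2 and C = 2])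
    show "(\<psi> has_real_derivative \<psi>' t) (at t)" for t
    proof -
      have "((\<lambda>t. max 0 (t - 1) powr 2) has_real_derivative 2 * max 0 (t - 1) powr (2 - 1) * 1) (at t)"
        by (rule DERIV_chain2[where f = "\<lambda>t. max 0 t powr 2" and g = "\<lambda>t. t - 1",
              OF has_real_derivative_max_0_powr]) (auto intro!: derivative_eq_intros)
      moreover have "((\<lambda>t. t\<^sup>2) has_real_derivative 2 * t) (at t)"
        by (auto intro!: derivative_eq_intros)
      ultimately have "((\<lambda>t. t\<^sup>2 - max 0 (t - 1) powr 2) has_real_derivative
          2 * t - 2 * max 0 (t - 1) powr (2 - 1) * 1) (at t)"
        by (rule DERIV_diff[rotated])
      then show ?thesis
        unfolding \<psi>_def[abs_def] \<psi>'_def by (rule DERIV_cong) simp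
    qed
    show "continuous_on UNIV \<psi>'"
      unfolding \<psi>'_def by (intro continuous_intros)
    show "\<bar>\<psi> t\<bar> \<le> 2 * t powr 2" if "0 \<le> t" for t
    proof -
      have "(max 0 (t - 1))\<^sup>2 \<le> t\<^sup>2"
        using that by (intro power_mono) auto
      then show ?thesis
        using that by (simp add: \<psi>_def powr_numeral)
    qed
    show "\<bar>\<psi>' t\<bar> \<le> 2 * t powr (2 - 1)" if "0 \<le> t" for t
      using that by (simp add: \<psi>'_def max_def)
  qed (use assms in auto)
  moreover have "L_fun z w = \<psi> (norm z + norm w) - norm w * \<psi>' (norm z + norm w)" for z w
    by (auto simp: L_fun_def \<psi>_def \<psi>'_def powr_numeral power2_eq_square algebra_simps)
  ultimately show ?thesis by simp
qed

text \<open>With \<open>\<psi> t = t\<^sup>p\<close> and \<open>t = a + b\<close> one has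
  \<open>\<psi> t - b \<psi>' t = (a + b - p b) t\<^sup>p\<^sup>-\<^sup>1\<close>.\<close>

lemma integral_Burkholder_kernel_eq_0:
  assumes f: "f \<in> stretch_functions1 \<inter> hom_sobolev p" and p: "1 < p"
  shows "has_bochner_integral lebesgue (\<lambda>z. (norm (d_z f z) - (p - 1) * norm (d_zbar f z)) *
    (norm (d_z f z) + norm (d_zbar f z)) powr (p - 1)) 0"
proof -
  obtain g g' where "slow_stretch f g g'"
    using f stretch_functions1_imp_slow_stretch by blast
  then interpret slow_stretch f g g' .
  have "has_bochner_integral lebesgue (\<lambda>z. max 0 (norm (d_z f z) + norm (d_zbar f z)) powr p -
    norm (d_zbar f z) * (p * max 0 (norm (d_z f z) + norm (d_zbar f z)) powr (p - 1))) 0"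
  proof (rule integral_radial_potential_eq_0[where p = p and C = p])
    show "\<bar>max 0 t powr p\<bar> \<le> p * t powr p" if "0 \<le> t" for t
      using that p mult_right_mono[of 1 p "t powr p"] by simp
  qed (use f p in \<open>auto intro!: has_real_derivative_max_0_powr continuous_on_max_0_powr continuous_on_mult_left\<close>)
  moreover have "max 0 (a + b) powr p - b * (p * max 0 (a + b) powr (p - 1)) =
      (a - (p - 1) * b) * (a + b) powr (p - 1)" if "0 \<le> a" "0 \<le> b" for a b
    using that powr_mult_base[of "a + b" "p - 1"] by (simp add: algebra_simps)
  ultimately show ?thesis by simp
qed

text \<open>For \<open>p \<le> 2\<close> the larger exponent is the conjugate one, so \<open>p\<^sup>* - 1 = 1 / (p - 1)\<close>; for \<open>p \<ge> 2\<close> it is \<open>p\<close>,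
  and exchanging the arguments changes the sign. Both \<open>\<Phi>\<^sub>p\<close> are thus multiples of the same kernel.\<close>

lemma Phi_le_2:
  assumes "1 < p" "p \<le> 2"
  shows "Phi p z w = alpha p / (p - 1) * ((norm z - (p - 1) * norm w) * (norm z + norm w) powr (p - 1))"
proof -
  have "p * (p - 1) \<le> p * 1" using assms by (intro mult_left_mono) auto
  then have "p_star p - 1 = 1 / (p - 1)"
    using assms by (simp add: p_star_def max_def field_simps)
  then show ?thesis
    unfolding Phi_def using assms by (simp only:) (simp add: field_simps)
qed

lemma Phi_ge_2:
  assumes "2 \<le> p"
  shows "Phi p w z = - alpha p * ((norm z - (p - 1) * norm w) * (norm z + norm w) powr (p - 1))"
proof -
  have "p * 1 \<le> p * (p - 1)" using assms by (intro mult_left_mono) auto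
  then have "p_star p = p"
    using assms by (simp add: p_star_def max_def field_simps)
  then show ?thesis
    by (simp add: Phi_def algebra_simps)
qed

theorem theorem1:
  shows "(\<forall>f \<in> stretch_functions1 \<inter> hom_sobolev 2.
            has_bochner_integral lebesgue (\<lambda>z. L_fun (d_z f z) (d_zbar f z)) 0) \<and>
         (\<forall>p. 1 < p \<and> p \<le> 2 \<longrightarrow>
            (\<forall>f \<in> stretch_functions1 \<inter> hom_sobolev p.
               has_bochner_integral lebesgue (\<lambda>z. Phi p (d_z f z) (d_zbar f z)) 0)) \<and>
         (\<forall>p. 2 \<le> p \<longrightarrow>
            (\<forall>f \<in> stretch_functions1 \<inter> hom_sobolev p.
               has_bochner_integral lebesgue (\<lambda>z. Phi p (d_zbar f z) (d_z f z)) 0))"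
proof (intro conjI ballI allI impI)
  fix f assume "f \<in> stretch_functions1 \<inter> hom_sobolev 2"
  then show "has_bochner_integral lebesgue (\<lambda>z. L_fun (d_z f z) (d_zbar f z)) 0"
    by (rule integral_L_fun_eq_0)
next
  fix p f assume p: "1 < p \<and> p \<le> 2" and f: "f \<in> stretch_functions1 \<inter> hom_sobolev p"
  show "has_bochner_integral lebesgue (\<lambda>z. Phi p (d_z f z) (d_zbar f z)) 0"
    using has_bochner_integral_mult_right[OF integral_Burkholder_kernel_eq_0[OF f], of "alpha p / (p - 1)"] p
    by (simp add: Phi_le_2)
next
  fix p f assume p: "2 \<le> p" and f: "f \<in> stretch_functions1 \<inter> hom_sobolev p"
  show "has_bochner_integral lebesgue (\<lambda>z. Phi p (d_zbar f z) (d_z f z)) 0"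
    using has_bochner_integral_mult_right[OF integral_Burkholder_kernel_eq_0[OF f], of "- alpha p"] p
    by (simp add: Phi_ge_2)
qed

end
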